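(* Let $\diamondsuit_t$ be the $(C_4+t)$-operator on $\mathbb F_q^2$. If $1\le p_1,p_2,p_3,p_4\le\infty$ satisfy $$\frac1{p_1}+\frac1{p_2}+\frac2{p_3}+\frac1{p_4}\le2,\qquad \frac2{p_1}+\frac1{p_2}+\frac1{p_3}+\frac1{p_4}\le2,\qquad \frac1{p_1}+\frac2{p_2}+\frac1{p_3}+\frac2{p_4}\le2,$$ and $(p_1,p_2,p_3,p_4)$ is neither $(2,2,2,\infty)$ nor $(2,\infty,2,2)$, then $\diamondsuit_t(p_1,p_2,p_3,p_4)\lesssim1$. In addition, $$\diamondsuit_t(2,\infty,2,2)\lessapprox1\quad\text{and}\quad\diamondsuit_t(2,2,2,\infty)\lessapprox1.$$
   Context: Conventions: $q$ ranges over powers of odd primes for which $3$ is a nonzero square in $\mathbb F_q$. For $x\in\mathbb F_q^2$ put $\|x\|=x_1^2+x_2^2$. For $t\in\mathbb F_q^*$, $S_t=\{x\in\mathbb F_q^2:\|x\|=t\}$, and $S_t(x)$ also denotes its indicator function. For $f:\mathbb F_q^2\to\mathbb R$: $\|f\|_p=(q^{-2}\sum_x|f(x)|^p)^{1/p}$ for $1\le p<\infty$ and $\|f\|_\infty=\max_x|f(x)|$. Exponents are extended real numbers, with $1/\infty=0$. The $(C_4+t)$-operator (graph $C_4$ + diagonal) on $\mathbb F_q^2$ is $$\diamondsuit_t(f_1,f_2,f_3,f_4)=\frac{1}{q^2|S_t|}\sum_{x^1,\dots,x^4\in\mathbb F_q^2}S_t(x^1-x^2)S_t(x^2-x^3)S_t(x^3-x^4)S_t(x^4-x^1)S_t(x^1-x^3)\prod_{i=1}^4f_i(x^i).$$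 $\diamondsuit_t(p_1,\dots,p_4)$ is the smallest constant such that $\diamondsuit_t(f_1,\dots,f_4)\le\diamondsuit_t(p_1,\dots,p_4)\prod_{i=1}^4\|f_i\|_{p_i}$ for all non-negative real-valued $f_i$. $\diamondsuit_t(p_1,\dots,p_4)\lesssim1$ means there is $C\ge1$, independent of $q$ and $t$, with $\diamondsuit_t(p_1,\dots,p_4)\le C$ for all such $q$ and all $t\in\mathbb F_q^*$. $\diamondsuit_t(p_1,\dots,p_4)\lessapprox1$ means that the corresponding inequality, with a constant independent of $q,t$, holds whenever all $f_i$ are indicator functions of subsets of $\mathbb F_q^2$. *)

theory Defs
  imports
    Complex_Main
    "HOL-Library.Extended_Real"
    "HOL-Library.Indicator_Function"
    "HOL-Computational_Algebra.Primes"
    "HOL-Algebra.Weak_Morphisms"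
begin

text \<open>The bounds below are uniform over all finite fields, so the field cannot be a type:
  it is a \<^locale>\<open>field\<close> record, and the field varies under a quantifier.\<close>

definition adm_field :: "('a, 'b) ring_scheme \<Rightarrow> bool" where
  "adm_field R \<longleftrightarrow> field R \<and> finite (carrier R) \<and>
     (\<exists>p k::nat. prime p \<and> odd p \<and> k \<ge> 1 \<and> card (carrier R) = p ^ k) \<and>
     [(3::nat)] \<cdot>\<^bsub>R\<^esub> \<one>\<^bsub>R\<^esub> \<noteq> \<zero>\<^bsub>R\<^esub> \<and>
     (\<exists>a\<in>carrier R. a [^]\<^bsub>R\<^esub> (2::nat) = [(3::nat)] \<cdot>\<^bsub>R\<^esub> \<one>\<^bsub>R\<^esub>)"

definition plane :: "('a, 'b) ring_scheme \<Rightarrow> ('a \<times> 'a) set" where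
  "plane R = carrier R \<times> carrier R"

definition qnorm :: "('a, 'b) ring_scheme \<Rightarrow> 'a \<times> 'a \<Rightarrow> 'a" where
  "qnorm R x = fst x [^]\<^bsub>R\<^esub> (2::nat) \<oplus>\<^bsub>R\<^esub> snd x [^]\<^bsub>R\<^esub> (2::nat)"

definition vdiff :: "('a, 'b) ring_scheme \<Rightarrow> 'a \<times> 'a \<Rightarrow> 'a \<times> 'a \<Rightarrow> 'a \<times> 'a" where
  "vdiff R x y = (fst x \<ominus>\<^bsub>R\<^esub> fst y, snd x \<ominus>\<^bsub>R\<^esub> snd y)"

definition circle :: "('a, 'b) ring_scheme \<Rightarrow> 'a \<Rightarrow> ('a \<times> 'a) set" where
  "circle R t = {x \<in> plane R. qnorm R x = t}"

definition Lp_norm :: "('a, 'b) ring_scheme \<Rightarrow> ereal \<Rightarrow> ('a \<times> 'a \<Rightarrow> real) \<Rightarrow> real" where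
  "Lp_norm R p f =
     (if p = \<infinity> then Max ((\<lambda>x. \<bar>f x\<bar>) ` plane R)
      else ((\<Sum>x\<in>plane R. \<bar>f x\<bar> powr real_of_ereal p) / real (card (carrier R)) ^ 2)
             powr (1 / real_of_ereal p))"

definition diamond ::
  "('a, 'b) ring_scheme \<Rightarrow> 'a \<Rightarrow> ('a \<times> 'a \<Rightarrow> real) \<Rightarrow> ('a \<times> 'a \<Rightarrow> real) \<Rightarrow>
     ('a \<times> 'a \<Rightarrow> real) \<Rightarrow> ('a \<times> 'a \<Rightarrow> real) \<Rightarrow> real" where
  "diamond R t f1 f2 f3 f4 =
     (1 / (real (card (carrier R)) ^ 2 * real (card (circle R t)))) *
     (\<Sum>x1\<in>plane R. \<Sum>x2\<in>plane R. \<Sum>x3\<in>plane R. \<Sum>x4\<in>plane R.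
        indicator (circle R t) (vdiff R x1 x2) * indicator (circle R t) (vdiff R x2 x3) *
        indicator (circle R t) (vdiff R x3 x4) * indicator (circle R t) (vdiff R x4 x1) *
        indicator (circle R t) (vdiff R x1 x3) * (f1 x1 * f2 x2 * f3 x3 * f4 x4))"

definition diamond_bound ::
  "('a, 'b) ring_scheme \<Rightarrow> 'a \<Rightarrow> ereal \<Rightarrow> ereal \<Rightarrow> ereal \<Rightarrow> ereal \<Rightarrow> real \<Rightarrow> bool" where
  "diamond_bound R t p1 p2 p3 p4 C \<longleftrightarrow>
     (\<forall>f1 f2 f3 f4. (\<forall>x\<in>plane R. 0 \<le> f1 x \<and> 0 \<le> f2 x \<and> 0 \<le> f3 x \<and> 0 \<le> f4 x) \<longrightarrow>
        diamond R t f1 f2 f3 f4 \<le>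
          C * (Lp_norm R p1 f1 * Lp_norm R p2 f2 * Lp_norm R p3 f3 * Lp_norm R p4 f4))"

text \<open>The infimum is taken in \<^typ>\<open>ereal\<close> so that it would be \<open>\<infinity>\<close> if no constant worked. It is
  attained (lemma \<open>diamond_const_le_iff\<close>), hence it is the smallest admissible constant.\<close>

definition diamond_const ::
  "('a, 'b) ring_scheme \<Rightarrow> 'a \<Rightarrow> ereal \<Rightarrow> ereal \<Rightarrow> ereal \<Rightarrow> ereal \<Rightarrow> ereal" where
  "diamond_const R t p1 p2 p3 p4 = (INF C\<in>{C. diamond_bound R t p1 p2 p3 p4 C}. ereal C)"

lemma Lp_norm_nonneg:
  assumes "finite (plane R)" "plane R \<noteq> {}"
  shows "0 \<le> Lp_norm R p f"
proof -
  from assms(2) obtain x where x: "x \<in> plane R" by blast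
  have "\<bar>f x\<bar> \<le> Max ((\<lambda>x. \<bar>f x\<bar>) ` plane R)"
    using assms(1) x by (intro Max_ge) auto
  then have "0 \<le> Max ((\<lambda>x. \<bar>f x\<bar>) ` plane R)"
    by (meson abs_ge_zero order_trans)
  then show ?thesis unfolding Lp_norm_def by simp
qed

lemma diamond_const_le_iff:
  assumes "adm_field R"
  shows "diamond_const R t p1 p2 p3 p4 \<le> ereal C \<longleftrightarrow> diamond_bound R t p1 p2 p3 p4 C"
proof
  assume "diamond_bound R t p1 p2 p3 p4 C"
  then show "diamond_const R t p1 p2 p3 p4 \<le> ereal C"
    unfolding diamond_const_def by (intro INF_lower) simp
next
  assume le: "diamond_const R t p1 p2 p3 p4 \<le> ereal C"
  interpret field R using assms by (simp add: adm_field_def)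
  have pl: "finite (plane R)" "plane R \<noteq> {}"
    using assms by (auto simp: adm_field_def plane_def)
  show "diamond_bound R t p1 p2 p3 p4 C"
    unfolding diamond_bound_def
  proof (intro allI impI)
    fix f1 f2 f3 f4 :: "'a \<times> 'a \<Rightarrow> real"
    assume nn: "\<forall>x\<in>plane R. 0 \<le> f1 x \<and> 0 \<le> f2 x \<and> 0 \<le> f3 x \<and> 0 \<le> f4 x"
    define N where "N = Lp_norm R p1 f1 * Lp_norm R p2 f2 * Lp_norm R p3 f3 * Lp_norm R p4 f4"
    have N: "0 \<le> N" unfolding N_def by (intro mult_nonneg_nonneg Lp_norm_nonneg pl)
    have *: "diamond R t f1 f2 f3 f4 \<le> (C + e) * N" if "e > 0" for e
    proof -
      have "diamond_const R t p1 p2 p3 p4 < ereal (C + e)"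
        using le that by (auto intro: order.strict_trans1)
      then obtain D where D: "diamond_bound R t p1 p2 p3 p4 D" "D < C + e"
        unfolding diamond_const_def by (auto simp: INF_less_iff)
      have "diamond R t f1 f2 f3 f4 \<le> D * N"
        using D(1) nn unfolding diamond_bound_def N_def by blast
      also have "\<dots> \<le> (C + e) * N" using D(2) N by (intro mult_right_mono) auto
      finally show ?thesis .
    qed
    have "diamond R t f1 f2 f3 f4 \<le> C * N"
    proof (rule field_le_epsilon)
      fix e :: real assume e: "e > 0"
      have "diamond R t f1 f2 f3 f4 \<le> (C + e / (N + 1)) * N" using e N by (intro *) auto
      also have "\<dots> = C * N + e * (N / (N + 1))" by (simp add: algebra_simps)
      also have "\<dots> \<le> C * N + e * 1"
        using e N by (intro add_left_mono mult_left_mono) auto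
      finally show "diamond R t f1 f2 f3 f4 \<le> C * N + e" by simp
    qed
    then show "diamond R t f1 f2 f3 f4 \<le>
        C * (Lp_norm R p1 f1 * Lp_norm R p2 f2 * Lp_norm R p3 f3 * Lp_norm R p4 f4)"
      by (simp add: N_def)
  qed
qed

text \<open>Quantifying over fields with carrier in \<^typ>\<open>nat\<close> loses nothing: every finite field is
  isomorphic to such a field.\<close>

lemma finite_field_on_nat:
  fixes R :: "('a, 'b) ring_scheme"
  assumes "field R" "finite (carrier R)"
  shows "\<exists>F :: nat ring. field F \<and> finite (carrier F) \<and> (\<exists>h. h \<in> ring_iso R F)"
proof -
  obtain h :: "'a \<Rightarrow> nat" where h: "inj_on h (carrier R)"
    using finite_imp_inj_to_nat_seg[OF assms(2)] by blast
  interpret field R by fact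
  have iso: "h \<in> ring_iso R (image_ring h R)" by (rule inj_imp_image_ring_iso[OF h])
  then have car: "carrier (image_ring h R) = h ` carrier R"
    by (auto simp: ring_iso_def bij_betw_def)
  have fld: "field (image_ring h R)" by (rule inj_imp_image_ring_is_field[OF h])
  show ?thesis using fld car iso assms(2) by (metis finite_imageI)
qed

text \<open>\<open>diamond_lesssim\<close> and \<open>diamond_lessapprox\<close> render the relations \<open>\<lesssim> 1\<close> and
  \<open>\<lessapprox> 1\<close> (restriction to indicator functions); the exponents are fixed before the constant.\<close>

definition diamond_lesssim :: "ereal \<Rightarrow> ereal \<Rightarrow> ereal \<Rightarrow> ereal \<Rightarrow> bool" where
  "diamond_lesssim p1 p2 p3 p4 \<longleftrightarrow>
     (\<exists>C::real. C \<ge> 1 \<and>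
        (\<forall>(R :: nat ring) t. adm_field R \<longrightarrow> t \<in> carrier R - {\<zero>\<^bsub>R\<^esub>} \<longrightarrow>
           diamond_const R t p1 p2 p3 p4 \<le> ereal C))"

definition diamond_lessapprox :: "ereal \<Rightarrow> ereal \<Rightarrow> ereal \<Rightarrow> ereal \<Rightarrow> bool" where
  "diamond_lessapprox p1 p2 p3 p4 \<longleftrightarrow>
     (\<exists>C::real. C \<ge> 1 \<and>
        (\<forall>(R :: nat ring) t. adm_field R \<longrightarrow> t \<in> carrier R - {\<zero>\<^bsub>R\<^esub>} \<longrightarrow>
           (\<forall>E1 E2 E3 E4. E1 \<subseteq> plane R \<and> E2 \<subseteq> plane R \<and> E3 \<subseteq> plane R \<and> E4 \<subseteq> plane R \<longrightarrow>
              diamond R t (indicator E1) (indicator E2) (indicator E3) (indicator E4) \<le>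
                C * (Lp_norm R p1 (indicator E1) * Lp_norm R p2 (indicator E2) *
                     Lp_norm R p3 (indicator E3) * Lp_norm R p4 (indicator E4)))))"

end

theory Submission
  imports Defs "HOL-Analysis.Convex" "HOL-Algebra.Multiplicative_Group"
begin

text \<open>Two distinct points of the plane have at most two common neighbours in the graph
  \<open>x ~ y \<longleftrightarrow> \<parallel>x - y\<parallel> = t\<close>, and this graph is regular of degree \<open>d \<ge> q/2\<close>; nothing else about the field is
  used. On the unit balls of the \<open>L\<^sup>p\<close> spaces, the set of exponents \<open>(1/p\<^sub>1, \<dots>, 1/p\<^sub>4)\<close> for which
  the form is bounded by a given constant is convex: by weighted AM-GM a product of functions is
  pointwise at most a convex combination of products of powers of them. Hence only the extreme points
  matter. With \<open>b = 1/p\<^sub>2 + 1/p\<^sub>4\<close> the region is a union of segments with end points \<open>1/p\<^sub>4 = 0\<close> and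
  \<open>1/p\<^sub>2 = 0\<close>, where the form reduces to the count of triangles, and the region of \<open>(1/p\<^sub>1, b, 1/p\<^sub>3)\<close>
  has the extreme points \<open>0\<close>, \<open>(1,0,0)\<close>, \<open>(2/3,2/3,0)\<close>, \<open>(1/2,1/2,1/2)\<close> up to permutation. The point
  \<open>(1/2,1/2,1/2)\<close> is of strong type as well: expanding \<open>\<Sum>\<^sub>z F(z)\<^sup>2\<close>, where \<open>F\<close> is the sum over the
  triangles at \<open>z\<close>, a quadruple \<open>x, y, x', y'\<close> is paired as \<open>(x, x'), (y, y')\<close>, and the common
  neighbour \<open>z\<close> is determined by either pair up to two choices. So the two exceptional exponents
  satisfy the same bound.\<close>

section \<open>Graphs with codegrees at most two\<close>

text \<open>Counting by codegrees produces bounds of order \<open>n\<^sup>2 / d\<close>; the density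
  assumption \<open>card_le\<close> turns them into multiples of \<open>n * d\<close>, the
  normalising factor of the operator.\<close>

locale sparse_graph =
  fixes V :: "'v set" and A :: "'v \<Rightarrow> 'v \<Rightarrow> real" and d :: real
  assumes finite_V: "finite V"
    and adj_01: "A x y \<in> {0, 1}"
    and adj_sym: "x \<in> V \<Longrightarrow> y \<in> V \<Longrightarrow> A x y = A y x"
    and adj_irrefl: "x \<in> V \<Longrightarrow> A x x = 0"
    and degree: "x \<in> V \<Longrightarrow> (\<Sum>y\<in>V. A x y) = d"
    and codegree: "x \<in> V \<Longrightarrow> y \<in> V \<Longrightarrow> x \<noteq> y \<Longrightarrow> (\<Sum>z\<in>V. A x z * A y z) \<le> 2"
    and d_pos: "0 < d"
    and card_le: "real (card V) \<le> 4 * d\<^sup>2"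
begin

abbreviation n :: real where "n \<equiv> real (card V)"

text \<open>The nonnegative unit ball of the normalised \<open>L\<^sup>p\<close> with \<open>a = 1/p\<close>.\<close>

definition unit_ball :: "real \<Rightarrow> ('v \<Rightarrow> real) \<Rightarrow> bool" where
  "unit_ball a f \<longleftrightarrow> (\<forall>x\<in>V. 0 \<le> f x) \<and>
     (if a = 0 then \<forall>x\<in>V. f x \<le> 1 else (\<Sum>x\<in>V. f x powr (1 / a)) \<le> n)"

definition tri :: "('v \<Rightarrow> real) \<Rightarrow> ('v \<Rightarrow> real) \<Rightarrow> ('v \<Rightarrow> real) \<Rightarrow> real" where
  "tri f g h = (\<Sum>x\<in>V. \<Sum>y\<in>V. \<Sum>z\<in>V. A x y * A y z * A z x * (f x * g y * h z))"

text \<open>The operator without its normalising factor; the edge between \<open>x1\<close> and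
  \<open>x3\<close> is the diagonal of the 4-cycle.\<close>

definition quad ::
  "('v \<Rightarrow> real) \<Rightarrow> ('v \<Rightarrow> real) \<Rightarrow> ('v \<Rightarrow> real) \<Rightarrow> ('v \<Rightarrow> real) \<Rightarrow> real" where
  "quad f1 f2 f3 f4 = (\<Sum>x1\<in>V. \<Sum>x2\<in>V. \<Sum>x3\<in>V. \<Sum>x4\<in>V.
     A x1 x2 * A x2 x3 * A x3 x4 * A x4 x1 * A x1 x3 * (f1 x1 * f2 x2 * f3 x3 * f4 x4))"

section \<open>Symmetries of the forms, and elimination of a bounded function\<close>

lemma adj_nonneg [simp]: "0 \<le> A x y" and adj_le_1: "A x y \<le> 1"
  using adj_01[of x y] by auto

lemma adj_idem [simp]: "A x y * A x y = A x y"
  using adj_01[of x y] by auto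

lemma codegree':
  assumes "x \<in> V" "y \<in> V"
  shows "A x y * (\<Sum>z\<in>V. A y z * A z x) \<le> 2 * A x y"
proof (cases "x = y")
  case True
  then show ?thesis using adj_irrefl assms by simp
next
  case False
  have "(\<Sum>z\<in>V. A y z * A z x) = (\<Sum>z\<in>V. A x z * A y z)"
    using assms by (intro sum.cong) (auto simp: adj_sym mult.commute)
  then show ?thesis
    using mult_left_mono[OF codegree[OF assms False], of "A x y"] by (simp add: mult.commute)
qed

lemma tri_swap12: "tri f g h = tri g f h"
proof -
  have "tri f g h = (\<Sum>y\<in>V. \<Sum>x\<in>V. \<Sum>z\<in>V. A x y * A y z * A z x * (f x * g y * h z))"
    unfolding tri_def by (rule sum.swap)
  also have "\<dots> = tri g f h"
    unfolding tri_def by (intro sum.cong refl) (simp add: adj_sym mult_ac)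
  finally show ?thesis .
qed

lemma tri_swap23: "tri f g h = tri f h g"
proof -
  have "tri f g h = (\<Sum>x\<in>V. \<Sum>z\<in>V. \<Sum>y\<in>V. A x y * A y z * A z x * (f x * g y * h z))"
    unfolding tri_def by (intro sum.cong refl sum.swap)
  also have "\<dots> = tri f h g"
    unfolding tri_def by (intro sum.cong refl) (simp add: adj_sym mult_ac)
  finally show ?thesis .
qed

lemma quad_swap24: "quad f1 f2 f3 f4 = quad f1 f4 f3 f2"
proof -
  have "quad f1 f2 f3 f4 = (\<Sum>x1\<in>V. \<Sum>x3\<in>V. \<Sum>x2\<in>V. \<Sum>x4\<in>V.
      A x1 x2 * A x2 x3 * A x3 x4 * A x4 x1 * A x1 x3 * (f1 x1 * f2 x2 * f3 x3 * f4 x4))"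
    unfolding quad_def by (intro sum.cong refl sum.swap)
  also have "\<dots> = (\<Sum>x1\<in>V. \<Sum>x3\<in>V. \<Sum>x4\<in>V. \<Sum>x2\<in>V.
      A x1 x2 * A x2 x3 * A x3 x4 * A x4 x1 * A x1 x3 * (f1 x1 * f2 x2 * f3 x3 * f4 x4))"
    by (intro sum.cong refl sum.swap)
  also have "\<dots> = (\<Sum>x1\<in>V. \<Sum>x4\<in>V. \<Sum>x3\<in>V. \<Sum>x2\<in>V.
      A x1 x2 * A x2 x3 * A x3 x4 * A x4 x1 * A x1 x3 * (f1 x1 * f2 x2 * f3 x3 * f4 x4))"
    by (intro sum.cong refl sum.swap)
  also have "\<dots> = quad f1 f4 f3 f2"
    unfolding quad_def by (intro sum.cong refl) (simp add: adj_sym mult_ac)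
  finally show ?thesis .
qed

text \<open>Once \<open>h\<close> is replaced by 1, the vertex \<open>z\<close> only has to complete
  an edge to a triangle, which leaves two choices.\<close>

lemma tri_le_edges:
  assumes "\<And>x. x \<in> V \<Longrightarrow> 0 \<le> f x" "\<And>x. x \<in> V \<Longrightarrow> 0 \<le> g x"
    and "\<And>x. x \<in> V \<Longrightarrow> 0 \<le> h x" "\<And>x. x \<in> V \<Longrightarrow> h x \<le> 1"
  shows "tri f g h \<le> 2 * (\<Sum>x\<in>V. \<Sum>y\<in>V. A x y * (f x * g y))"
proof -
  have "(\<Sum>z\<in>V. A x y * A y z * A z x * (f x * g y * h z)) \<le> 2 * (A x y * (f x * g y))"
    if "x \<in> V" "y \<in> V" for x y
  proof -
    have "(\<Sum>z\<in>V. A x y * A y z * A z x * (f x * g y * h z))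
        \<le> (\<Sum>z\<in>V. A x y * A y z * A z x * (f x * g y))"
      using assms that by (intro sum_mono mult_left_mono mult_left_le) auto
    also have "\<dots> = A x y * (\<Sum>z\<in>V. A y z * A z x) * (f x * g y)"
      by (simp add: sum_distrib_left sum_distrib_right mult_ac)
    also have "\<dots> \<le> 2 * A x y * (f x * g y)"
      using assms that by (intro mult_right_mono codegree') auto
    finally show ?thesis by simp
  qed
  then show ?thesis unfolding tri_def sum_distrib_left by (intro sum_mono) simp
qed

text \<open>Once \<open>f4\<close> is replaced by 1, the vertex \<open>x4\<close> is a free apex
  over the diagonal \<open>x1\<close>, \<open>x3\<close>, which leaves two choices.\<close>

lemma quad_le_tri:
  assumes "\<And>x. x \<in> V \<Longrightarrow> 0 \<le> f1 x" "\<And>x. x \<in> V \<Longrightarrow> 0 \<le> f2 x" "\<And>x. x \<in> V \<Longrightarrow> 0 \<le> f3 x"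
    and "\<And>x. x \<in> V \<Longrightarrow> 0 \<le> f4 x" "\<And>x. x \<in> V \<Longrightarrow> f4 x \<le> 1"
  shows "quad f1 f2 f3 f4 \<le> 2 * tri f1 f2 f3"
proof -
  have "(\<Sum>x4\<in>V. A x1 x2 * A x2 x3 * A x3 x4 * A x4 x1 * A x1 x3 * (f1 x1 * f2 x2 * f3 x3 * f4 x4))
      \<le> 2 * (A x1 x2 * A x2 x3 * A x3 x1 * (f1 x1 * f2 x2 * f3 x3))"
    if "x1 \<in> V" "x2 \<in> V" "x3 \<in> V" for x1 x2 x3
  proof -
    have "(\<Sum>x4\<in>V. A x1 x2 * A x2 x3 * A x3 x4 * A x4 x1 * A x1 x3 * (f1 x1 * f2 x2 * f3 x3 * f4 x4))
        \<le> (\<Sum>x4\<in>V. A x1 x2 * A x2 x3 * A x3 x4 * A x4 x1 * A x1 x3 * (f1 x1 * f2 x2 * f3 x3))"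
      using assms that by (intro sum_mono mult_left_mono mult_left_le) auto
    also have "\<dots> = A x1 x2 * A x2 x3 * (f1 x1 * f2 x2 * f3 x3) *
        (A x1 x3 * (\<Sum>x4\<in>V. A x3 x4 * A x4 x1))"
      by (simp add: sum_distrib_left sum_distrib_right mult_ac)
    also have "\<dots> \<le> A x1 x2 * A x2 x3 * (f1 x1 * f2 x2 * f3 x3) * (2 * A x1 x3)"
      using assms that by (intro mult_left_mono codegree') auto
    finally show ?thesis using that by (simp add: adj_sym mult_ac)
  qed
  then show ?thesis unfolding quad_def tri_def sum_distrib_left by (intro sum_mono) simp
qed

end

section \<open>Interpolation between exponent points\<close>

lemma powr_interpolate:
  fixes u a b c s :: real
  assumes "0 < a" "0 \<le> u" "(1 - s) * b + s * c = a"
  shows "u \<le> (u powr (b / a)) powr (1 - s) * (u powr (c / a)) powr s"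
proof (cases "u = 0")
  case False
  have "b / a * (1 - s) + c / a * s = 1"
    using assms by (simp add: field_simps)
  then show ?thesis
    using False assms by (simp add: powr_powr flip: powr_add)
qed simp

lemma weighted_AM_GM:
  fixes u v s :: real
  assumes "0 \<le> u" "0 \<le> v" "0 \<le> s" "s \<le> 1"
  shows "u powr (1 - s) * v powr s \<le> (1 - s) * u + s * v"
\<comment> \<open>Young's inequality needs positive arguments; if one of them is 0, the left side is
  0, because \<open>0 powr s = 0\<close> even for \<open>s = 0\<close>.\<close>
proof (cases "u = 0 \<or> v = 0")
  case False
  then show ?thesis using assms by (intro Youngs_inequality_0) auto
qed (use assms in auto)

lemma sum4_interpolate:
  fixes K F G H :: "'a \<Rightarrow> 'a \<Rightarrow> 'a \<Rightarrow> 'a \<Rightarrow> real" and s :: real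
  assumes "\<And>x1 x2 x3 x4. 0 \<le> K x1 x2 x3 x4"
    and "\<And>x1 x2 x3 x4. x1 \<in> V \<Longrightarrow> x2 \<in> V \<Longrightarrow> x3 \<in> V \<Longrightarrow> x4 \<in> V \<Longrightarrow>
      F x1 x2 x3 x4 \<le> (1 - s) * G x1 x2 x3 x4 + s * H x1 x2 x3 x4"
  shows "(\<Sum>x1\<in>V. \<Sum>x2\<in>V. \<Sum>x3\<in>V. \<Sum>x4\<in>V. K x1 x2 x3 x4 * F x1 x2 x3 x4) \<le>
    (1 - s) * (\<Sum>x1\<in>V. \<Sum>x2\<in>V. \<Sum>x3\<in>V. \<Sum>x4\<in>V. K x1 x2 x3 x4 * G x1 x2 x3 x4) +
    s * (\<Sum>x1\<in>V. \<Sum>x2\<in>V. \<Sum>x3\<in>V. \<Sum>x4\<in>V. K x1 x2 x3 x4 * H x1 x2 x3 x4)"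
proof -
  have "K x1 x2 x3 x4 * F x1 x2 x3 x4 \<le>
      (1 - s) * (K x1 x2 x3 x4 * G x1 x2 x3 x4) + s * (K x1 x2 x3 x4 * H x1 x2 x3 x4)"
    if "x1 \<in> V" "x2 \<in> V" "x3 \<in> V" "x4 \<in> V" for x1 x2 x3 x4
    using mult_left_mono[OF assms(2)[OF that] assms(1)] by (simp add: algebra_simps)
  then show ?thesis
    unfolding sum_distrib_left sum.distrib[symmetric] by (intro sum_mono)
qed

context sparse_graph
begin

text \<open>\<open>pw a b\<close> carries the unit ball for \<open>a\<close> into the one for \<open>b\<close>. For \<open>a = 0\<close> the constant \<open>1\<close>
  suffices, because only an upper bound for \<open>f\<close> is needed.\<close>

definition pw :: "real \<Rightarrow> real \<Rightarrow> ('v \<Rightarrow> real) \<Rightarrow> 'v \<Rightarrow> real" where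
  "pw a b f x = (if a = 0 then 1 else f x powr (b / a))"

lemma pw_nonneg [simp]: "0 \<le> pw a b f x"
  by (simp add: pw_def)

lemma unit_ball_pw:
  assumes "unit_ball a f" "0 \<le> a" "0 \<le> b"
  shows "unit_ball b (pw a b f)"
proof -
  consider "a = 0" | "a \<noteq> 0" "b = 0" | "0 < a" "0 < b"
    using assms by fastforce
  then show ?thesis
  proof cases
    case 3
    then show ?thesis using assms by (simp add: unit_ball_def pw_def powr_powr)
  qed (auto simp: unit_ball_def pw_def powr_def)
qed

lemma le_pw_prod:
  assumes "unit_ball ((1 - s) * b + s * c) f" (is "unit_ball ?a f")
    and "x \<in> V" "0 \<le> b" "0 \<le> c" "0 \<le> s" "s \<le> 1"
  shows "f x \<le> pw ?a b f x powr (1 - s) * pw ?a c f x powr s"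
proof (cases "?a = 0")
  case True
  then show ?thesis using assms(1,2) by (simp add: unit_ball_def pw_def)
next
  case False
  moreover have "0 \<le> ?a" using assms by simp
  ultimately have "0 < ?a" by linarith
  moreover have "0 \<le> f x" using assms(1,2) by (simp add: unit_ball_def)
  ultimately show ?thesis
    using False powr_interpolate[of ?a "f x" s b c] by (simp add: pw_def)
qed

text \<open>The coordinates are the reciprocals of the exponents, since interpolation is linear in
  these. Testing on unit balls suffices by homogeneity.\<close>

definition adm :: "real \<Rightarrow> (real \<times> real \<times> real \<times> real) set" where
  "adm C = {(a1, a2, a3, a4). 0 \<le> a1 \<and> 0 \<le> a2 \<and> 0 \<le> a3 \<and> 0 \<le> a4 \<and>
     (\<forall>f1 f2 f3 f4. unit_ball a1 f1 \<and> unit_ball a2 f2 \<and> unit_ball a3 f3 \<and> unit_ball a4 f4 \<longrightarrow>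
        quad f1 f2 f3 f4 \<le> C)}"

lemma adm_swap24: "(a1, a2, a3, a4) \<in> adm C \<Longrightarrow> (a1, a4, a3, a2) \<in> adm C"
  unfolding adm_def using quad_swap24 by force

text \<open>A real-variable form of Riesz-Thorin interpolation for a nonnegative kernel. Each
  function is bounded by a geometric mean of two powers, one in the unit ball of each end point;
  AM-GM is then applied once, to the product of all four, so the constant \<open>C\<close> does not
  grow.\<close>

lemma convex_adm: "convex (adm C)"
  unfolding convex_alt
proof (intro ballI allI impI)
  fix v w :: "real \<times> real \<times> real \<times> real" and s :: real
  assume v: "v \<in> adm C" and w: "w \<in> adm C" and s: "0 \<le> s \<and> s \<le> 1"
  obtain b1 b2 b3 b4 where vb: "v = (b1, b2, b3, b4)" by (cases v)
  obtain c1 c2 c3 c4 where wc: "w = (c1, c2, c3, c4)" by (cases w)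
  define m where "m b c = (1 - s) * b + s * c" for b c
  have pos: "0 \<le> b1" "0 \<le> b2" "0 \<le> b3" "0 \<le> b4" "0 \<le> c1" "0 \<le> c2" "0 \<le> c3" "0 \<le> c4"
    using v w by (auto simp: adm_def vb wc)
  have bv: "quad g1 g2 g3 g4 \<le> C" if "unit_ball b1 g1" "unit_ball b2 g2" "unit_ball b3 g3" "unit_ball b4 g4" for g1 g2 g3 g4
    using v that by (auto simp: adm_def vb)
  have bw: "quad g1 g2 g3 g4 \<le> C" if "unit_ball c1 g1" "unit_ball c2 g2" "unit_ball c3 g3" "unit_ball c4 g4" for g1 g2 g3 g4
    using w that by (auto simp: adm_def wc)
  have m_pos: "0 \<le> m b c" if "0 \<le> b" "0 \<le> c" for b c
    using that s by (simp add: m_def)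
  have "quad f1 f2 f3 f4 \<le> C"
    if f: "unit_ball (m b1 c1) f1" "unit_ball (m b2 c2) f2" "unit_ball (m b3 c3) f3" "unit_ball (m b4 c4) f4"
    for f1 f2 f3 f4
  proof -
    define G where "G x1 x2 x3 x4 = pw (m b1 c1) b1 f1 x1 * pw (m b2 c2) b2 f2 x2 *
        pw (m b3 c3) b3 f3 x3 * pw (m b4 c4) b4 f4 x4" for x1 x2 x3 x4
    define H where "H x1 x2 x3 x4 = pw (m b1 c1) c1 f1 x1 * pw (m b2 c2) c2 f2 x2 *
        pw (m b3 c3) c3 f3 x3 * pw (m b4 c4) c4 f4 x4" for x1 x2 x3 x4
    have pt: "f1 x1 * f2 x2 * f3 x3 * f4 x4 \<le> (1 - s) * G x1 x2 x3 x4 + s * H x1 x2 x3 x4"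
      if x: "x1 \<in> V" "x2 \<in> V" "x3 \<in> V" "x4 \<in> V" for x1 x2 x3 x4
    proof -
      have nn: "0 \<le> f1 x1" "0 \<le> f2 x2" "0 \<le> f3 x3" "0 \<le> f4 x4"
        using f x by (auto simp: unit_ball_def)
      have le: "f1 x1 \<le> pw (m b1 c1) b1 f1 x1 powr (1 - s) * pw (m b1 c1) c1 f1 x1 powr s"
          "f2 x2 \<le> pw (m b2 c2) b2 f2 x2 powr (1 - s) * pw (m b2 c2) c2 f2 x2 powr s"
          "f3 x3 \<le> pw (m b3 c3) b3 f3 x3 powr (1 - s) * pw (m b3 c3) c3 f3 x3 powr s"
          "f4 x4 \<le> pw (m b4 c4) b4 f4 x4 powr (1 - s) * pw (m b4 c4) c4 f4 x4 powr s"
        using f x pos s unfolding m_def by (simp_all add: le_pw_prod)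
      have "f1 x1 * f2 x2 * f3 x3 * f4 x4 \<le>
          (pw (m b1 c1) b1 f1 x1 powr (1 - s) * pw (m b1 c1) c1 f1 x1 powr s) *
          (pw (m b2 c2) b2 f2 x2 powr (1 - s) * pw (m b2 c2) c2 f2 x2 powr s) *
          (pw (m b3 c3) b3 f3 x3 powr (1 - s) * pw (m b3 c3) c3 f3 x3 powr s) *
          (pw (m b4 c4) b4 f4 x4 powr (1 - s) * pw (m b4 c4) c4 f4 x4 powr s)"
        by (intro mult_mono le mult_nonneg_nonneg nn powr_ge_zero)
      also have "\<dots> = G x1 x2 x3 x4 powr (1 - s) * H x1 x2 x3 x4 powr s"
        by (simp add: G_def H_def powr_mult mult_ac)
      also have "\<dots> \<le> (1 - s) * G x1 x2 x3 x4 + s * H x1 x2 x3 x4"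
        using s by (intro weighted_AM_GM) (auto simp: G_def H_def)
      finally show ?thesis .
    qed
    have "quad f1 f2 f3 f4 \<le> (1 - s) * quad (pw (m b1 c1) b1 f1) (pw (m b2 c2) b2 f2) (pw (m b3 c3) b3 f3) (pw (m b4 c4) b4 f4)
        + s * quad (pw (m b1 c1) c1 f1) (pw (m b2 c2) c2 f2) (pw (m b3 c3) c3 f3) (pw (m b4 c4) c4 f4)"
      unfolding quad_def
    proof (rule sum4_interpolate)
    qed (use pt in \<open>simp_all add: G_def H_def\<close>)
    also have "\<dots> \<le> (1 - s) * C + s * C"
    proof (intro add_mono mult_left_mono)
      show "quad (pw (m b1 c1) b1 f1) (pw (m b2 c2) b2 f2) (pw (m b3 c3) b3 f3) (pw (m b4 c4) b4 f4) \<le> C"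
        by (intro bv unit_ball_pw f m_pos pos)
      show "quad (pw (m b1 c1) c1 f1) (pw (m b2 c2) c2 f2) (pw (m b3 c3) c3 f3) (pw (m b4 c4) c4 f4) \<le> C"
        by (intro bw unit_ball_pw f m_pos pos)
    qed (use s in auto)
    finally show ?thesis by (simp add: algebra_simps)
  qed
  then show "(1 - s) *\<^sub>R v + s *\<^sub>R w \<in> adm C"
    using m_pos pos by (auto simp: adm_def vb wc m_def)
qed

end

section \<open>Convex combinations of the extreme points for sorted coordinates\<close>

lemma convex_flag_combination:
  fixes e f g :: "'a::real_vector"
  assumes "convex S" "0 \<in> S" "e \<in> S" "(2/3) *\<^sub>R (e + f) \<in> S" "(1/2) *\<^sub>R (e + f + g) \<in> S"
    and "y \<le> x" "z \<le> y" "0 \<le> z" "2 * x + y + z \<le> 2"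
  shows "x *\<^sub>R e + y *\<^sub>R f + z *\<^sub>R g \<in> S"
proof -
  \<comment> \<open>Abel summation writes the point as \<open>(x - y) *\<^sub>R e + (y - z)
    *\<^sub>R (e + f) + z *\<^sub>R (e + f + g)\<close>. Rescaling the partial sums to the given
    points of \<open>S\<close> multiplies these coefficients by 1, 3/2 and 2; they total
    \<open>x + y / 2 + z / 2\<close>, which is at most 1, and the remaining weight goes to
    0.\<close>
  define a :: "nat \<Rightarrow> real" where
    "a i = (if i = 0 then x - y else if i = 1 then 3/2 * (y - z) else if i = 2 then 2 * z else 1 - x - y / 2 - z / 2)" for i
  define v where
    "v i = (if i = 0 then e else if i = 1 then (2/3) *\<^sub>R (e + f) else if i = 2 then (1/2) *\<^sub>R (e + f + g) else 0)" for i :: nat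
  have "(\<Sum>i<4. a i *\<^sub>R v i) \<in> S"
  proof (rule convex_sum)
    show "(\<Sum>i<4. a i) = 1"
      by (simp add: a_def eval_nat_numeral field_simps)
  qed (use assms in \<open>auto simp: a_def v_def\<close>)
  moreover have "(\<Sum>i<4. a i *\<^sub>R v i) =
      (x - y) *\<^sub>R e + (y - z) *\<^sub>R (e + f) + z *\<^sub>R (e + f + g)"
    by (simp add: a_def v_def eval_nat_numeral del: scaleR_add_right)
  moreover have "\<dots> = x *\<^sub>R e + y *\<^sub>R f + z *\<^sub>R g"
    by (simp add: algebra_simps)
  ultimately show ?thesis by simp
qed

section \<open>Power sums, and the edge form with both exponents 3/2\<close>

lemma sum_squares_cube_le:
  fixes u :: "'a \<Rightarrow> real"
  assumes "finite W" "\<And>x. x \<in> W \<Longrightarrow> 0 \<le> u x"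
  shows "(\<Sum>x\<in>W. (u x)\<^sup>2) ^ 3 \<le> card W * (\<Sum>x\<in>W. (u x) ^ 3)\<^sup>2"
proof -
  \<comment> \<open>Cauchy-Schwarz is used twice, for \<open>p\<close> against \<open>q\<close> and
    for \<open>q\<close> against \<open>p\<close> and \<open>r\<close>. Eliminating the first power
    sum \<open>p\<close> leaves the comparison of \<open>q\<close> with \<open>r\<close>, up to a
    common factor \<open>q\<close>.\<close>
  define p q r where "p = (\<Sum>x\<in>W. u x)" and "q = (\<Sum>x\<in>W. (u x)\<^sup>2)" and "r = (\<Sum>x\<in>W. (u x) ^ 3)"
  have nn: "0 \<le> p" "0 \<le> q" "0 \<le> r"
    using assms by (auto simp: p_def q_def r_def intro: sum_nonneg)
  have "p\<^sup>2 \<le> card W * q"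
    using Cauchy_Schwarz_ineq_sum[of "\<lambda>_. 1" u W] by (simp add: p_def q_def)
  moreover have "q\<^sup>2 \<le> p * r"
  proof -
    have "q = (\<Sum>x\<in>W. sqrt (u x) * (u x * sqrt (u x)))"
      unfolding q_def using assms(2) by (intro sum.cong) (auto simp: power2_eq_square)
    moreover have "(\<Sum>x\<in>W. (sqrt (u x))\<^sup>2) = p" "(\<Sum>x\<in>W. (u x * sqrt (u x))\<^sup>2) = r"
      unfolding p_def r_def using assms(2)
      by (auto intro!: sum.cong simp: power_mult_distrib power2_eq_square power3_eq_cube)
    ultimately show ?thesis
      using Cauchy_Schwarz_ineq_sum[of "\<lambda>x. sqrt (u x)" "\<lambda>x. u x * sqrt (u x)" W] by simp
  qed
  ultimately have "q ^ 3 * q \<le> (card W * r\<^sup>2) * q"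
  proof -
    assume *: "p\<^sup>2 \<le> card W * q" "q\<^sup>2 \<le> p * r"
    have "q ^ 3 * q = (q\<^sup>2)\<^sup>2" by (simp add: eval_nat_numeral)
    also have "\<dots> \<le> (p * r)\<^sup>2" using * by (intro power_mono) auto
    also have "\<dots> = p\<^sup>2 * r\<^sup>2" by (simp add: power_mult_distrib)
    also have "\<dots> \<le> (card W * q) * r\<^sup>2" using * by (intro mult_right_mono) auto
    finally show ?thesis by (simp add: mult_ac)
  qed
  then have "q ^ 3 \<le> card W * r\<^sup>2"
    using nn by (cases "q = 0") auto
  then show ?thesis by (simp add: q_def r_def)
qed

text \<open>Splitting off the largest term \<open>m\<close>: the square of the sum of the remaining cubes is at most
  the off-diagonal part \<open>(\<Sum>u\<^sup>3)\<^sup>2 - \<Sum>u\<^sup>6\<close>, since \<open>m\<close> dominates every other term.\<close>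

lemma sum_squares_cube_le_off_diagonal:
  fixes u :: "'a \<Rightarrow> real"
  assumes "finite W" "\<And>x. x \<in> W \<Longrightarrow> 0 \<le> u x"
  shows "(\<Sum>x\<in>W. (u x)\<^sup>2) ^ 3 \<le>
    4 * ((\<Sum>x\<in>W. (u x) ^ 6) + card W * ((\<Sum>x\<in>W. (u x) ^ 3)\<^sup>2 - (\<Sum>x\<in>W. (u x) ^ 6)))"
proof (cases "W = {}")
  case False
  then have "Max (u ` W) \<in> u ` W" using assms(1) by (intro Max_in) auto
  then obtain w where w': "w \<in> W" "u w = Max (u ` W)" by force
  have w: "w \<in> W" "\<And>x. x \<in> W \<Longrightarrow> u x \<le> u w"
    using w' assms(1) by auto
  define W' where "W' = W - {w}"
  have fin: "finite W'" using assms by (simp add: W'_def)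
  have split: "(\<Sum>x\<in>W. h x) = h w + (\<Sum>x\<in>W'. h x)" for h :: "'a \<Rightarrow> real"
    unfolding W'_def using assms(1) w(1) by (rule sum.remove)
  define q r where "q = (\<Sum>x\<in>W'. (u x)\<^sup>2)" and "r = (\<Sum>x\<in>W'. (u x) ^ 3)"
  have nn: "0 \<le> u x" if "x \<in> W'" for x using that assms(2) by (auto simp: W'_def)
  have qr: "0 \<le> q" "0 \<le> r" using nn by (auto simp: q_def r_def intro: sum_nonneg)
  have uw: "0 \<le> u w" using assms w by auto
  have "q ^ 3 \<le> card W' * r\<^sup>2"
    unfolding q_def r_def using fin nn by (rule sum_squares_cube_le)
  also have "\<dots> \<le> card W * r\<^sup>2"
    by (intro mult_right_mono) (auto simp: W'_def intro!: card_mono assms)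
  finally have q3: "q ^ 3 \<le> card W * r\<^sup>2" .
  have six: "(\<Sum>x\<in>W'. (u x) ^ 6) \<le> (u w) ^ 3 * r"
    unfolding r_def sum_distrib_left
  proof (rule sum_mono)
    fix x assume x: "x \<in> W'"
    have "(u x) ^ 6 = (u x) ^ 3 * (u x) ^ 3" by (simp flip: power_add)
    also have "\<dots> \<le> (u w) ^ 3 * (u x) ^ 3"
      using x nn[OF x] w(2)[of x] by (intro mult_right_mono power_mono) (auto simp: W'_def)
    finally show "(u x) ^ 6 \<le> (u w) ^ 3 * (u x) ^ 3" .
  qed
  have u6: "((u w) ^ 3)\<^sup>2 = (u w) ^ 6" "((u w)\<^sup>2) ^ 3 = (u w) ^ 6" by (simp_all flip: power_mult)
  have "r\<^sup>2 \<le> ((u w) ^ 3 + r)\<^sup>2 - ((u w) ^ 6 + (\<Sum>x\<in>W'. (u x) ^ 6))"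
    using six mult_nonneg_nonneg[OF zero_le_power[OF uw, of 3] qr(2)]
    by (simp add: power2_sum u6)
  then have off: "r\<^sup>2 \<le> (\<Sum>x\<in>W. (u x) ^ 3)\<^sup>2 - (\<Sum>x\<in>W. (u x) ^ 6)"
    by (simp add: split r_def)
  have "(\<Sum>x\<in>W. (u x)\<^sup>2) ^ 3 = ((u w)\<^sup>2 + q) ^ 3" by (simp add: split q_def)
  \<comment> \<open>The constant 4 is that of \<open>(a + q) ^ 3 \<le> 4 * (a ^ 3 + q ^ 3)\<close>,
    where the difference of the two sides is \<open>3 * (a + q) * (a - q)\<^sup>2\<close>.\<close>
  also have "\<dots> \<le> 4 * (((u w)\<^sup>2) ^ 3 + q ^ 3)"
  proof -
    have "0 \<le> 3 * (a + q) * (a - q)\<^sup>2" if "0 \<le> a" for a using that qr by simp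
    from this[of "(u w)\<^sup>2"] show ?thesis
      by (simp add: power2_eq_square power3_eq_cube algebra_simps)
  qed
  also have "\<dots> \<le> 4 * ((\<Sum>x\<in>W. (u x) ^ 6) + card W * r\<^sup>2)"
    using q3 sum_nonneg[of W' "\<lambda>x. (u x) ^ 6"] nn by (simp add: split u6)
  also have "\<dots> \<le> 4 * ((\<Sum>x\<in>W. (u x) ^ 6) + card W * ((\<Sum>x\<in>W. (u x) ^ 3)\<^sup>2 - (\<Sum>x\<in>W. (u x) ^ 6)))"
    using off by (intro mult_left_mono add_left_mono) auto
  finally show ?thesis .
qed simp

context sparse_graph
begin

text \<open>Expanding the square counts the common neighbours of \<open>x\<close> and
  \<open>x'\<close>: there are \<open>d\<close> of them on the diagonal and at most two off
  it.\<close>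

lemma sum_square_neighbours_le:
  assumes "\<And>x. x \<in> V \<Longrightarrow> 0 \<le> h x"
  shows "(\<Sum>y\<in>V. (\<Sum>x\<in>V. A x y * h x)\<^sup>2) \<le> 2 * (\<Sum>x\<in>V. h x)\<^sup>2 + d * (\<Sum>x\<in>V. (h x)\<^sup>2)"
proof -
  have "(\<Sum>y\<in>V. (\<Sum>x\<in>V. A x y * h x)\<^sup>2) =
      (\<Sum>y\<in>V. \<Sum>x\<in>V. \<Sum>x'\<in>V. (A x y * h x) * (A x' y * h x'))"
    by (simp add: power2_eq_square sum_product)
  also have "\<dots> = (\<Sum>x\<in>V. \<Sum>y\<in>V. \<Sum>x'\<in>V. (A x y * h x) * (A x' y * h x'))"
    by (rule sum.swap)
  also have "\<dots> = (\<Sum>x\<in>V. \<Sum>x'\<in>V. \<Sum>y\<in>V. (A x y * h x) * (A x' y * h x'))"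
    by (intro sum.cong refl sum.swap)
  also have "\<dots> = (\<Sum>x\<in>V. \<Sum>x'\<in>V. (h x * h x') * (\<Sum>y\<in>V. A x y * A x' y))"
    by (simp add: sum_distrib_left mult_ac)
  also have "\<dots> \<le> (\<Sum>x\<in>V. \<Sum>x'\<in>V. (h x * h x') * (2 + (if x' = x then d else 0)))"
  proof (intro sum_mono mult_left_mono)
    fix x x' assume "x \<in> V" "x' \<in> V"
    then show "(\<Sum>y\<in>V. A x y * A x' y) \<le> 2 + (if x' = x then d else 0)"
      using codegree[of x x'] degree[of x] by auto
  qed (use assms in auto)
  also have "\<dots> = (\<Sum>x\<in>V. \<Sum>x'\<in>V. 2 * (h x * h x') + (if x' = x then d * (h x)\<^sup>2 else 0))"
    by (intro sum.cong refl) (auto simp: algebra_simps power2_eq_square)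
  also have "\<dots> = 2 * (\<Sum>x\<in>V. h x)\<^sup>2 + d * (\<Sum>x\<in>V. (h x)\<^sup>2)"
    by (simp add: sum.distrib finite_V power2_eq_square sum_product flip: sum_distrib_left)
  finally show ?thesis .
qed

text \<open>With \<open>f = u\<^sup>2\<close> this is the bound of the neighbour sum from exponent
  3/2 to exponent 3. The power-sum inequality is applied on each neighbourhood, a set of size
  \<open>d\<close>. Its off-diagonal form is essential: the factor \<open>d\<close> then multiplies
  only pairs of distinct points, and these have few common neighbours.\<close>

lemma sum_cube_neighbours_le:
  assumes "\<And>x. x \<in> V \<Longrightarrow> 0 \<le> u x"
  shows "(\<Sum>y\<in>V. (\<Sum>x\<in>V. A x y * (u x)\<^sup>2) ^ 3) \<le> 12 * d * (\<Sum>x\<in>V. (u x) ^ 3)\<^sup>2"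
proof -
  define S where "S = (\<Sum>x\<in>V. (u x) ^ 3)"
  have pt: "(\<Sum>x\<in>V. A x y * (u x)\<^sup>2) ^ 3 \<le> 4 * ((\<Sum>x\<in>V. A x y * (u x) ^ 6) +
      d * ((\<Sum>x\<in>V. A x y * (u x) ^ 3)\<^sup>2 - (\<Sum>x\<in>V. A x y * (u x) ^ 6)))" if "y \<in> V" for y
  proof -
    define W where "W = {x \<in> V. A x y = 1}"
    have W: "(\<Sum>x\<in>V. A x y * h x) = (\<Sum>x\<in>W. h x)" for h :: "'v \<Rightarrow> real"
    proof -
      have "(\<Sum>x\<in>V. A x y * h x) = (\<Sum>x\<in>V. if A x y = 1 then h x else 0)"
        using adj_01[of _ y] by (intro sum.cong) auto
      then show ?thesis by (simp add: W_def sum.inter_filter finite_V)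
    qed
    have "real (card W) = (\<Sum>x\<in>V. A x y)" using W[of "\<lambda>_. 1"] by simp
    also have "\<dots> = (\<Sum>x\<in>V. A y x)" using that by (intro sum.cong) (auto simp: adj_sym)
    finally have "real (card W) = d" using that by (simp add: degree)
    moreover have "finite W" using finite_V by (simp add: W_def)
    ultimately show ?thesis
      using sum_squares_cube_le_off_diagonal[of W u] assms by (simp add: W) (simp add: W_def)
  qed
  have six: "(\<Sum>x\<in>V. (u x) ^ 6) \<le> S\<^sup>2"
  proof -
    have "(\<Sum>x\<in>V. (u x) ^ 6) \<le> (\<Sum>x\<in>V. (u x) ^ 3 * S)"
    proof (rule sum_mono)
      fix x assume x: "x \<in> V"
      have "(u x) ^ 6 = (u x) ^ 3 * (u x) ^ 3" by (simp flip: power_add)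
      also have "\<dots> \<le> (u x) ^ 3 * S"
        unfolding S_def using x assms finite_V by (intro mult_left_mono member_le_sum) auto
      finally show "(u x) ^ 6 \<le> (u x) ^ 3 * S" .
    qed
    then show ?thesis by (simp add: S_def power2_eq_square sum_distrib_right)
  qed
  have deg: "(\<Sum>y\<in>V. \<Sum>x\<in>V. A x y * h x) = d * (\<Sum>x\<in>V. h x)" for h
  proof -
    have "(\<Sum>y\<in>V. \<Sum>x\<in>V. A x y * h x) = (\<Sum>x\<in>V. \<Sum>y\<in>V. A x y * h x)" by (rule sum.swap)
    also have "\<dots> = (\<Sum>x\<in>V. (\<Sum>y\<in>V. A x y) * h x)" by (simp add: sum_distrib_right)
    finally show ?thesis by (simp add: degree sum_distrib_left)
  qed
  have "(\<Sum>y\<in>V. (\<Sum>x\<in>V. A x y * (u x)\<^sup>2) ^ 3) \<le> (\<Sum>y\<in>V. 4 * ((\<Sum>x\<in>V. A x y * (u x) ^ 6) +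
      d * ((\<Sum>x\<in>V. A x y * (u x) ^ 3)\<^sup>2 - (\<Sum>x\<in>V. A x y * (u x) ^ 6))))"
    by (intro sum_mono pt)
  also have "\<dots> = 4 * (d * (\<Sum>x\<in>V. (u x) ^ 6) +
      d * ((\<Sum>y\<in>V. (\<Sum>x\<in>V. A x y * (u x) ^ 3)\<^sup>2) - d * (\<Sum>x\<in>V. (u x) ^ 6)))"
    by (simp add: sum.distrib sum_subtractf deg flip: sum_distrib_left)
  \<comment> \<open>The diagonal term of \<open>sum_square_neighbours_le\<close> is exactly the sum
    of sixth powers subtracted here, so only \<open>2 * S\<^sup>2\<close> survives; 12 is 4 times 1
    + 2.\<close>
  also have "\<dots> \<le> 4 * (d * S\<^sup>2 + d * (2 * S\<^sup>2))"
    using sum_square_neighbours_le[of "\<lambda>x. (u x) ^ 3"] assms d_pos six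
    by (intro mult_left_mono add_mono) (auto simp: S_def simp flip: power_mult)
  finally show ?thesis by (simp add: S_def)
qed

lemma edges_le_three_halves:
  assumes "unit_ball (2/3) f" "unit_ball (2/3) g"
  shows "(\<Sum>x\<in>V. \<Sum>y\<in>V. A x y * (f x * g y)) \<le> 49 * (n * d)"
proof -
  define N where "N y = (\<Sum>x\<in>V. A x y * f x)" for y
  have nn: "0 \<le> f x" "0 \<le> g x" if "x \<in> V" for x
    using assms that by (auto simp: unit_ball_def)
  \<comment> \<open>Passing to square roots turns the exponent 3/2 into the integer powers of
    \<open>sum_cube_neighbours_le\<close>.\<close>
  have cube: "sqrt t ^ 3 = t powr (3/2)" if "0 \<le> t" for t :: real
    using that by (cases "t = 0") (auto simp: powr_half_sqrt[symmetric] powr_powr simp flip: powr_realpow)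
  have f: "(\<Sum>x\<in>V. sqrt (f x) ^ 3) \<le> n" and g: "(\<Sum>x\<in>V. sqrt (g x) ^ 3) \<le> n"
    using assms nn by (auto simp: unit_ball_def cube cong: sum.cong)
  have N3: "(\<Sum>y\<in>V. N y ^ 3) \<le> 12 * d * n\<^sup>2"
  proof -
    have "(\<Sum>y\<in>V. N y ^ 3) = (\<Sum>y\<in>V. (\<Sum>x\<in>V. A x y * (sqrt (f x))\<^sup>2) ^ 3)"
      using nn by (simp add: N_def)
    also have "\<dots> \<le> 12 * d * (\<Sum>x\<in>V. sqrt (f x) ^ 3)\<^sup>2"
      using nn by (intro sum_cube_neighbours_le) auto
    also have "\<dots> \<le> 12 * d * n\<^sup>2"
      using f d_pos nn by (intro mult_left_mono power_mono sum_nonneg) auto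
    finally show ?thesis .
  qed
  \<comment> \<open>A pointwise substitute for Hoelder with exponents 3 and 3/2: compare
    \<open>N y\<close> with \<open>d * sqrt (g y)\<close> and eliminate \<open>N y\<close> or
    \<open>g y\<close> accordingly. The threshold \<open>d\<close> makes both resulting sums of
    order \<open>n * d\<close>.\<close>
  have pt: "N y * g y \<le> d * sqrt (g y) ^ 3 + N y ^ 3 / d\<^sup>2" if "y \<in> V" for y
  proof (cases "N y \<le> d * sqrt (g y)")
    case True
    have "0 \<le> N y" unfolding N_def using nn by (intro sum_nonneg) auto
    then have "0 \<le> N y ^ 3 / d\<^sup>2" by simp
    moreover have "N y * g y \<le> d * sqrt (g y) * g y" 
      using True nn that by (intro mult_right_mono) auto
    moreover have "d * sqrt (g y) * g y = d * sqrt (g y) ^ 3"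
      using nn that by (simp add: power3_eq_cube)
    ultimately show ?thesis by linarith
  next
    case False
    then have le: "sqrt (g y) \<le> N y / d" using d_pos by (simp add: field_simps)
    have "0 \<le> N y" unfolding N_def using nn by (intro sum_nonneg) auto
    then have "N y * (sqrt (g y))\<^sup>2 \<le> N y * (N y / d)\<^sup>2"
      using le nn that by (intro mult_left_mono power_mono) auto
    then have "N y * g y \<le> N y ^ 3 / d\<^sup>2"
      using nn that by (simp add: power_divide power3_eq_cube power2_eq_square)
    moreover have "0 \<le> d * sqrt (g y) ^ 3" using d_pos nn that by simp
    ultimately show ?thesis by linarith
  qed
  have "(\<Sum>x\<in>V. \<Sum>y\<in>V. A x y * (f x * g y)) = (\<Sum>y\<in>V. \<Sum>x\<in>V. A x y * (f x * g y))"
    by (rule sum.swap)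
  also have "\<dots> = (\<Sum>y\<in>V. N y * g y)" by (simp add: N_def sum_distrib_left mult_ac)
  also have "\<dots> \<le> (\<Sum>y\<in>V. d * sqrt (g y) ^ 3 + N y ^ 3 / d\<^sup>2)" by (intro sum_mono pt)
  also have "\<dots> = d * (\<Sum>y\<in>V. sqrt (g y) ^ 3) + (\<Sum>y\<in>V. N y ^ 3) / d\<^sup>2"
    by (simp add: sum.distrib sum_distrib_left sum_divide_distrib)
  also have "\<dots> \<le> d * n + 12 * d * n\<^sup>2 / d\<^sup>2"
    using g N3 d_pos by (intro add_mono mult_left_mono divide_right_mono) auto
  \<comment> \<open>The density bound costs a factor 4, so the total is 1 + 4 * 12 = 49.\<close>
  also have "12 * d * n\<^sup>2 / d\<^sup>2 \<le> 48 * (n * d)"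
    using mult_left_mono[OF card_le, of n] d_pos by (simp add: field_simps power2_eq_square)
  finally show ?thesis by (simp add: algebra_simps)
qed


section \<open>The triangle form with all three exponents 2\<close>

abbreviation M :: "'v \<Rightarrow> 'v \<Rightarrow> 'v \<Rightarrow> real" where
  "M z x y \<equiv> A x y * A y z * A z x"

text \<open>The factor \<open>A z x\<close> is kept on the right so that a later sum over
  \<open>z\<close> can still be counted by a codegree.\<close>

lemma sum_M_y:
  assumes "z \<in> V" "x \<in> V"
  shows "(\<Sum>y\<in>V. M z x y) \<le> 2 * A z x"
proof -
  have "(\<Sum>y\<in>V. M z x y) = A z x * (\<Sum>y\<in>V. A x y * A y z)"
    by (simp add: sum_distrib_left mult_ac)
  then show ?thesis using codegree'[OF assms] by simp
qed

lemma sum_M_z: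
  assumes "x \<in> V" "y \<in> V"
  shows "(\<Sum>z\<in>V. M z x y) \<le> 2"
proof -
  have "(\<Sum>z\<in>V. M z x y) = A x y * (\<Sum>z\<in>V. A y z * A z x)"
    by (simp add: sum_distrib_left mult_ac)
  then show ?thesis using codegree'[OF assms] adj_le_1[of x y] by linarith
qed

lemma M_swap: "z \<in> V \<Longrightarrow> x \<in> V \<Longrightarrow> y \<in> V \<Longrightarrow> M z x y = M z y x"
  by (simp add: adj_sym mult_ac)

text \<open>A weighted sum over two triangles \<open>z, x, y\<close> and \<open>z, x', y'\<close>
  with a common apex, as it arises from squaring the sum over the triangles at \<open>z\<close>. The
  arguments of \<open>B\<close> are ordered by the pairing of \<open>x\<close> with
  \<open>x'\<close> and of \<open>y\<close> with \<open>y'\<close>.\<close>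

definition pairs :: "('v \<Rightarrow> 'v \<Rightarrow> 'v \<Rightarrow> 'v \<Rightarrow> real) \<Rightarrow> real" where
  "pairs B = (\<Sum>z\<in>V. \<Sum>x\<in>V. \<Sum>x'\<in>V. \<Sum>y\<in>V. \<Sum>y'\<in>V. M z x y * M z x' y' * B x x' y y')"

lemma pairs_add: "pairs (\<lambda>x x' y y'. B x x' y y' + B' x x' y y') = pairs B + pairs B'"
  by (simp add: pairs_def distrib_left sum.distrib)

lemma pairs_mono:
  assumes "\<And>x x' y y'. x \<in> V \<Longrightarrow> x' \<in> V \<Longrightarrow> y \<in> V \<Longrightarrow> y' \<in> V \<Longrightarrow> B x x' y y' \<le> B' x x' y y'"
  shows "pairs B \<le> pairs B'"
  unfolding pairs_def using assms by (intro sum_mono mult_left_mono) auto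

lemma pairs_scale: "pairs (\<lambda>x x' y y'. c * B x x' y y') = c * pairs B"
  by (simp add: pairs_def sum_distrib_left mult_ac)

text \<open>\<open>M\<close> is symmetric in its last two arguments; hence every estimate for the
  pair \<open>x, x'\<close> carries over to \<open>y, y'\<close>.\<close>

lemma pairs_flip: "pairs B = pairs (\<lambda>x x' y y'. B y y' x x')"
proof -
  have *: "(\<Sum>x\<in>V. \<Sum>x'\<in>V. \<Sum>y\<in>V. \<Sum>y'\<in>V. M z x y * M z x' y' * B x x' y y') =
      (\<Sum>x\<in>V. \<Sum>x'\<in>V. \<Sum>y\<in>V. \<Sum>y'\<in>V. M z x y * M z x' y' * B y y' x x')" if z: "z \<in> V" for z
  proof -
    let ?t = "\<lambda>x x' y y'. M z x y * M z x' y' * B x x' y y'"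
    have "(\<Sum>x\<in>V. \<Sum>x'\<in>V. \<Sum>y\<in>V. \<Sum>y'\<in>V. ?t x x' y y') =
        (\<Sum>x\<in>V. \<Sum>y\<in>V. \<Sum>x'\<in>V. \<Sum>y'\<in>V. ?t x x' y y')"
      by (intro sum.cong refl sum.swap)
    also have "\<dots> = (\<Sum>y\<in>V. \<Sum>x\<in>V. \<Sum>x'\<in>V. \<Sum>y'\<in>V. ?t x x' y y')" by (rule sum.swap)
    also have "\<dots> = (\<Sum>y\<in>V. \<Sum>x\<in>V. \<Sum>y'\<in>V. \<Sum>x'\<in>V. ?t x x' y y')"
      by (intro sum.cong refl sum.swap)
    also have "\<dots> = (\<Sum>y\<in>V. \<Sum>y'\<in>V. \<Sum>x\<in>V. \<Sum>x'\<in>V. ?t x x' y y')"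
      by (intro sum.cong refl sum.swap)
    also have "\<dots> = (\<Sum>x\<in>V. \<Sum>x'\<in>V. \<Sum>y\<in>V. \<Sum>y'\<in>V. M z x y * M z x' y' * B y y' x x')"
      using z by (intro sum.cong refl) (simp only: M_swap)
    finally show ?thesis .
  qed
  show ?thesis unfolding pairs_def by (rule sum.cong[OF refl]) (rule *)
qed

text \<open>Distinct \<open>x\<close> and \<open>x'\<close> have at most two common neighbours
  \<open>z\<close>; then each of the edges from \<open>z\<close> to \<open>x\<close> and to
  \<open>x'\<close> has at most two completions, \<open>y\<close> and \<open>y'\<close>. This gives
  2 * 2 * 2 = 8.\<close>

lemma pairs_off_diagonal:
  "pairs (\<lambda>x x' y y'. if x = x' then 0 else (f x)\<^sup>2 * (f x')\<^sup>2) \<le> 8 * (\<Sum>x\<in>V. (f x)\<^sup>2)\<^sup>2"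
proof -
  let ?P = "\<lambda>x x'. if x = x' then 0 else (f x)\<^sup>2 * (f x')\<^sup>2"
  have "pairs (\<lambda>x x' y y'. ?P x x') = (\<Sum>z\<in>V. \<Sum>x\<in>V. \<Sum>x'\<in>V. ?P x x' * ((\<Sum>y\<in>V. M z x y) * (\<Sum>y'\<in>V. M z x' y')))"
    unfolding pairs_def sum_product by (simp only: sum_distrib_left mult_ac)
  also have "\<dots> \<le> (\<Sum>z\<in>V. \<Sum>x\<in>V. \<Sum>x'\<in>V. ?P x x' * ((2 * A z x) * (2 * A z x')))"
    by (intro sum_mono mult_left_mono mult_mono sum_M_y sum_nonneg) auto
  also have "\<dots> = (\<Sum>x\<in>V. \<Sum>z\<in>V. \<Sum>x'\<in>V. ?P x x' * ((2 * A z x) * (2 * A z x')))"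
    by (rule sum.swap)
  also have "\<dots> = (\<Sum>x\<in>V. \<Sum>x'\<in>V. \<Sum>z\<in>V. ?P x x' * ((2 * A z x) * (2 * A z x')))"
    by (intro sum.cong refl sum.swap)
  also have "\<dots> \<le> (\<Sum>x\<in>V. \<Sum>x'\<in>V. 8 * ((f x)\<^sup>2 * (f x')\<^sup>2))"
  proof (intro sum_mono)
    fix x x' assume x: "x \<in> V" "x' \<in> V"
    show "(\<Sum>z\<in>V. ?P x x' * ((2 * A z x) * (2 * A z x'))) \<le> 8 * ((f x)\<^sup>2 * (f x')\<^sup>2)"
    proof (cases "x = x'")
      case False
      have "(\<Sum>z\<in>V. ?P x x' * ((2 * A z x) * (2 * A z x'))) =
          4 * ((f x)\<^sup>2 * (f x')\<^sup>2) * (\<Sum>z\<in>V. A x z * A x' z)"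
        unfolding sum_distrib_left using False x by (intro sum.cong) (auto simp: adj_sym)
      also have "\<dots> \<le> 4 * ((f x)\<^sup>2 * (f x')\<^sup>2) * 2"
        using False x by (intro mult_left_mono codegree) auto
      finally show ?thesis by simp
    qed simp
  qed
  also have "\<dots> = 8 * (\<Sum>x\<in>V. (f x)\<^sup>2)\<^sup>2"
    by (simp add: power2_eq_square sum_product flip: sum_distrib_left)
  finally show ?thesis .
qed

text \<open>For \<open>x = x'\<close> the edge between \<open>x\<close> and \<open>y\<close> leaves
  two choices of \<open>z\<close>, after which the edge between \<open>z\<close> and
  \<open>x\<close> leaves two choices of \<open>y'\<close>.\<close>

lemma pairs_diagonal:
  "pairs (\<lambda>x x' y y'. if x = x' then (f x)\<^sup>2 * (g y)\<^sup>2 else 0) \<le> 4 * ((\<Sum>x\<in>V. (f x)\<^sup>2) * (\<Sum>x\<in>V. (g x)\<^sup>2))"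
proof -
  have "pairs (\<lambda>x x' y y'. if x = x' then (f x)\<^sup>2 * (g y)\<^sup>2 else 0) =
     (\<Sum>z\<in>V. \<Sum>x\<in>V. \<Sum>x'\<in>V. if x = x' then (\<Sum>y\<in>V. \<Sum>y'\<in>V. M z x y * M z x y' * ((f x)\<^sup>2 * (g y)\<^sup>2)) else 0)"
    unfolding pairs_def by (intro sum.cong refl) auto
  also have "\<dots> = (\<Sum>z\<in>V. \<Sum>x\<in>V. \<Sum>y\<in>V. \<Sum>y'\<in>V. M z x y * M z x y' * ((f x)\<^sup>2 * (g y)\<^sup>2))"
    by (simp add: finite_V)
  also have "\<dots> \<le> (\<Sum>z\<in>V. \<Sum>x\<in>V. \<Sum>y\<in>V. 2 * M z x y * ((f x)\<^sup>2 * (g y)\<^sup>2))"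
  proof (intro sum_mono)
    fix z x y assume V: "z \<in> V" "x \<in> V" "y \<in> V"
    have "(\<Sum>y'\<in>V. M z x y * M z x y' * ((f x)\<^sup>2 * (g y)\<^sup>2)) =
        M z x y * ((f x)\<^sup>2 * (g y)\<^sup>2) * (\<Sum>y'\<in>V. M z x y')"
      unfolding sum_distrib_left by (simp only: mult_ac)
    also have "\<dots> \<le> M z x y * ((f x)\<^sup>2 * (g y)\<^sup>2) * 2"
      using sum_M_y[OF V(1,2)] adj_le_1[of z x] by (intro mult_left_mono) auto
    finally show "(\<Sum>y'\<in>V. M z x y * M z x y' * ((f x)\<^sup>2 * (g y)\<^sup>2)) \<le> 2 * M z x y * ((f x)\<^sup>2 * (g y)\<^sup>2)"
      by (simp add: mult_ac)
  qed
  also have "\<dots> = (\<Sum>x\<in>V. \<Sum>z\<in>V. \<Sum>y\<in>V. 2 * M z x y * ((f x)\<^sup>2 * (g y)\<^sup>2))"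
    by (rule sum.swap)
  also have "\<dots> = (\<Sum>x\<in>V. \<Sum>y\<in>V. \<Sum>z\<in>V. 2 * M z x y * ((f x)\<^sup>2 * (g y)\<^sup>2))"
    by (intro sum.cong refl sum.swap)
  also have "\<dots> \<le> (\<Sum>x\<in>V. \<Sum>y\<in>V. 4 * ((f x)\<^sup>2 * (g y)\<^sup>2))"
  proof (intro sum_mono)
    fix x y assume V: "x \<in> V" "y \<in> V"
    have "(\<Sum>z\<in>V. 2 * M z x y * ((f x)\<^sup>2 * (g y)\<^sup>2)) = 2 * ((f x)\<^sup>2 * (g y)\<^sup>2) * (\<Sum>z\<in>V. M z x y)"
      unfolding sum_distrib_left by (simp only: mult_ac)
    also have "\<dots> \<le> 2 * ((f x)\<^sup>2 * (g y)\<^sup>2) * 2"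
      using sum_M_z[OF V] by (intro mult_left_mono) auto
    finally show "(\<Sum>z\<in>V. 2 * M z x y * ((f x)\<^sup>2 * (g y)\<^sup>2)) \<le> 4 * ((f x)\<^sup>2 * (g y)\<^sup>2)"
      by simp
  qed
  also have "\<dots> = 4 * ((\<Sum>x\<in>V. (f x)\<^sup>2) * (\<Sum>x\<in>V. (g x)\<^sup>2))"
    by (simp add: sum_product flip: sum_distrib_left)
  finally show ?thesis .
qed


lemma sum_square_wedge_le:
  assumes "\<And>x. x \<in> V \<Longrightarrow> 0 \<le> f x" "\<And>x. x \<in> V \<Longrightarrow> 0 \<le> g x"
    and f: "(\<Sum>x\<in>V. (f x)\<^sup>2) \<le> n" and g: "(\<Sum>x\<in>V. (g x)\<^sup>2) \<le> n"
  shows "(\<Sum>z\<in>V. (\<Sum>x\<in>V. \<Sum>y\<in>V. M z x y * (f x * g y))\<^sup>2) \<le> 16 * n\<^sup>2"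
proof -
  define F G where "F = (\<Sum>x\<in>V. (f x)\<^sup>2)" and "G = (\<Sum>x\<in>V. (g x)\<^sup>2)"
  have nn: "0 \<le> F" "0 \<le> G" by (auto simp: F_def G_def intro: sum_nonneg)
  have FG: "F * G \<le> n\<^sup>2" "F\<^sup>2 \<le> n\<^sup>2" "G\<^sup>2 \<le> n\<^sup>2"
    using mult_mono[of F n G n] power_mono[of F n 2] power_mono[of G n 2] f g nn
    by (simp_all add: power2_eq_square[of n] flip: F_def G_def)
  have square: "(\<Sum>x\<in>V. \<Sum>y\<in>V. M z x y * (f x * g y))\<^sup>2 =
      (\<Sum>x\<in>V. \<Sum>x'\<in>V. \<Sum>y\<in>V. \<Sum>y'\<in>V. M z x y * M z x' y' * (f x * f x' * (g y * g y')))" for z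
    unfolding power2_eq_square sum_product by (simp only: mult_ac)
  have "(\<Sum>z\<in>V. (\<Sum>x\<in>V. \<Sum>y\<in>V. M z x y * (f x * g y))\<^sup>2) =
      pairs (\<lambda>x x' y y'. f x * f x' * (g y * g y'))"
    unfolding pairs_def square ..
  also have "\<dots> \<le> pairs (\<lambda>x x' y y'. 1/2 *
      (((if x = x' then 0 else (f x)\<^sup>2 * (f x')\<^sup>2) + (if y = y' then 0 else (g y)\<^sup>2 * (g y')\<^sup>2)) +
       (((if x = x' then (f x)\<^sup>2 * (g y)\<^sup>2 else 0) + (if x = x' then (f x)\<^sup>2 * (g y')\<^sup>2 else 0)) +
        ((if y = y' then (g y)\<^sup>2 * (f x)\<^sup>2 else 0) + (if y = y' then (g y)\<^sup>2 * (f x')\<^sup>2 else 0)))))"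
  proof (rule pairs_mono)
    fix x x' y y'
    have "2 * (f x * f x' * (g y * g y')) \<le> (f x * f x')\<^sup>2 + (g y * g y')\<^sup>2"
      using sum_squares_bound[of "f x * f x'" "g y * g y'"] by (simp add: mult_ac)
    moreover have "2 * (f x * g y * (f x' * g y')) \<le> (f x * g y)\<^sup>2 + (f x' * g y')\<^sup>2"
      using sum_squares_bound[of "f x * g y" "f x' * g y'"] by (simp add: mult_ac)
    moreover define p1 p2 p3 p4 p5 p6 where
      "p1 = (if x = x' then 0 else (f x)\<^sup>2 * (f x')\<^sup>2)" and
      "p2 = (if y = y' then 0 else (g y)\<^sup>2 * (g y')\<^sup>2)" and
      "p3 = (if x = x' then (f x)\<^sup>2 * (g y)\<^sup>2 else 0)" and
      "p4 = (if x = x' then (f x)\<^sup>2 * (g y')\<^sup>2 else 0)" and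
      "p5 = (if y = y' then (g y)\<^sup>2 * (f x)\<^sup>2 else 0)" and
      "p6 = (if y = y' then (g y)\<^sup>2 * (f x')\<^sup>2 else 0)"
    \<comment> \<open>If both pairs are distinct, AM-GM is applied across the triangles, which
      yields \<open>p1 + p2\<close>. If \<open>x = x'\<close> or \<open>y = y'\<close>, a pair no
      longer determines \<open>z\<close> up to two choices; AM-GM is then applied to the edges
      \<open>x, y\<close> and \<open>x', y'\<close>, which yields \<open>p3 + p4\<close> or
      \<open>p5 + p6\<close>.\<close>
    ultimately have "2 * (f x * f x' * (g y * g y')) \<le> p1 + p2 \<or>
        2 * (f x * f x' * (g y * g y')) \<le> p3 + p4 \<or> 2 * (f x * f x' * (g y * g y')) \<le> p5 + p6"
      by (cases "x = x'"; cases "y = y'") (simp_all add: power_mult_distrib mult_ac)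
    moreover have "0 \<le> p1" "0 \<le> p2" "0 \<le> p3" "0 \<le> p4" "0 \<le> p5" "0 \<le> p6"
      by (simp_all add: p1_def p2_def p3_def p4_def p5_def p6_def)
    ultimately have "f x * f x' * (g y * g y') \<le> 1/2 * ((p1 + p2) + ((p3 + p4) + (p5 + p6)))"
      by auto
    then show "f x * f x' * (g y * g y') \<le> 1/2 *
      (((if x = x' then 0 else (f x)\<^sup>2 * (f x')\<^sup>2) + (if y = y' then 0 else (g y)\<^sup>2 * (g y')\<^sup>2)) +
       (((if x = x' then (f x)\<^sup>2 * (g y)\<^sup>2 else 0) + (if x = x' then (f x)\<^sup>2 * (g y')\<^sup>2 else 0)) +
        ((if y = y' then (g y)\<^sup>2 * (f x)\<^sup>2 else 0) + (if y = y' then (g y)\<^sup>2 * (f x')\<^sup>2 else 0))))"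
      unfolding p1_def p2_def p3_def p4_def p5_def p6_def .
  qed
  also have "\<dots> \<le> 1/2 * ((8 * F\<^sup>2 + 8 * G\<^sup>2) + ((4 * (F * G) + 4 * (F * G)) + (4 * (G * F) + 4 * (G * F))))"
  proof -
    have 1: "pairs (\<lambda>x x' y y'. if y = y' then 0 else (g y)\<^sup>2 * (g y')\<^sup>2) \<le> 8 * G\<^sup>2"
      unfolding G_def by (subst pairs_flip) (rule pairs_off_diagonal)
    \<comment> \<open>Where \<open>x = x'\<close>, the two triangles share an edge and
      \<open>y\<close>, \<open>y'\<close> can be interchanged.\<close>
    have swap: "pairs (\<lambda>x x' y y'. if x = x' then (a x)\<^sup>2 * (b y')\<^sup>2 else 0) =
        pairs (\<lambda>x x' y y'. if x = x' then (a x)\<^sup>2 * (b y)\<^sup>2 else 0)" for a b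
    proof -
      have "(\<Sum>x\<in>V. \<Sum>x'\<in>V. \<Sum>y\<in>V. \<Sum>y'\<in>V. M z x y * M z x' y' * (if x = x' then (a x)\<^sup>2 * (b y')\<^sup>2 else 0)) =
        (\<Sum>x\<in>V. \<Sum>x'\<in>V. \<Sum>y'\<in>V. \<Sum>y\<in>V. M z x y * M z x' y' * (if x = x' then (a x)\<^sup>2 * (b y')\<^sup>2 else 0))" for z
        by (intro sum.cong refl sum.swap)
      note * = this
      show ?thesis
        unfolding pairs_def
        by (rule sum.cong[OF refl], rule trans[OF *], intro sum.cong refl) (simp add: mult_ac)
    qed
    show ?thesis
      unfolding pairs_scale pairs_add
      by (intro mult_left_mono add_mono 1 pairs_off_diagonal[of f, folded F_def]
           pairs_diagonal[of f g, folded F_def G_def]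
           pairs_diagonal[of f g, folded F_def G_def, folded swap]
           pairs_diagonal[of g f, folded F_def G_def, unfolded pairs_flip[of "\<lambda>x x' y y'. if x = x' then (g x)\<^sup>2 * (f y)\<^sup>2 else 0"]]
           pairs_diagonal[of g f, folded F_def G_def, folded swap, unfolded pairs_flip[of "\<lambda>x x' y y'. if x = x' then (g x)\<^sup>2 * (f y')\<^sup>2 else 0"]])
         simp
  qed
  also have "\<dots> \<le> 16 * n\<^sup>2" using FG by (simp add: mult.commute)
  finally show ?thesis .
qed

lemma tri_le_half:
  assumes "unit_ball (1/2) f" "unit_ball (1/2) g" "unit_ball (1/2) h"
  shows "tri f g h \<le> 33 * (n * d)"
proof -
  have nn: "0 \<le> f x" "0 \<le> g x" "0 \<le> h x" if "x \<in> V" for x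
    using assms that by (auto simp: unit_ball_def)
  have sq: "(\<Sum>x\<in>V. (k x)\<^sup>2) \<le> n" if "unit_ball (1/2) k" for k
  proof -
    have "(\<Sum>x\<in>V. (k x)\<^sup>2) = (\<Sum>x\<in>V. k x powr (1 / (1/2)))"
      using that by (intro sum.cong) (auto simp: unit_ball_def)
    moreover have "(\<Sum>x\<in>V. k x powr (1 / (1/2))) \<le> n"
      using that unfolding unit_ball_def by auto
    ultimately show ?thesis by simp
  qed
  define F where "F z = (\<Sum>x\<in>V. \<Sum>y\<in>V. M z x y * (f x * g y))" for z
  have "tri f g h = (\<Sum>x\<in>V. \<Sum>z\<in>V. \<Sum>y\<in>V. M z x y * (f x * g y * h z))"
    unfolding tri_def by (intro sum.cong refl sum.swap)
  also have "\<dots> = (\<Sum>z\<in>V. \<Sum>x\<in>V. \<Sum>y\<in>V. M z x y * (f x * g y * h z))"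
    by (rule sum.swap)
  also have "\<dots> = (\<Sum>z\<in>V. F z * h z)"
    by (simp add: F_def sum_distrib_left mult_ac)
  \<comment> \<open>AM-GM with weight \<open>d\<close> balances the two parts: the squares of
    \<open>F\<close> sum to at most \<open>16 * n\<^sup>2\<close>, hence to at most
    \<open>64 * n * d\<^sup>2\<close>, so both parts have order \<open>n * d\<close>.\<close>
  also have "\<dots> \<le> (\<Sum>z\<in>V. ((F z)\<^sup>2 / d + d * (h z)\<^sup>2) / 2)"
  proof (rule sum_mono)
    fix z
    have "2 * (F z / d) * h z \<le> (F z / d)\<^sup>2 + (h z)\<^sup>2" by (rule sum_squares_bound)
    then have "d * (2 * (F z / d) * h z) \<le> d * ((F z / d)\<^sup>2 + (h z)\<^sup>2)"
      using d_pos by (intro mult_left_mono) auto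
    moreover have "d * (2 * (F z / d) * h z) = 2 * (F z * h z)"
      and "d * ((F z / d)\<^sup>2 + (h z)\<^sup>2) = (F z)\<^sup>2 / d + d * (h z)\<^sup>2"
      using d_pos by (simp_all add: field_simps power2_eq_square)
    ultimately show "F z * h z \<le> ((F z)\<^sup>2 / d + d * (h z)\<^sup>2) / 2" by simp
  qed
  also have "\<dots> = ((\<Sum>z\<in>V. (F z)\<^sup>2) / d + d * (\<Sum>z\<in>V. (h z)\<^sup>2)) / 2"
    by (simp add: sum.distrib add_divide_distrib sum_divide_distrib sum_distrib_left)
  also have "\<dots> \<le> (16 * n\<^sup>2 / d + d * n) / 2"
    unfolding F_def using d_pos nn
    by (intro divide_right_mono add_mono mult_left_mono sum_square_wedge_le sq assms) auto
  also have "16 * n\<^sup>2 / d \<le> 64 * (n * d)"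
    using mult_left_mono[OF card_le, of n] d_pos by (simp add: field_simps power2_eq_square)
  finally have "tri f g h \<le> 65 / 2 * (n * d)" by (simp add: algebra_simps)
  also have "\<dots> \<le> 33 * (n * d)" using d_pos by (intro mult_right_mono) auto
  finally show ?thesis .
qed

section \<open>The extreme points and the region they span\<close>

lemma tri_le_one:
  assumes "unit_ball 1 f" "unit_ball 0 g" "unit_ball 0 h"
  shows "tri f g h \<le> 98 * (n * d)"
proof -
  have "tri f g h \<le> 2 * (\<Sum>x\<in>V. \<Sum>y\<in>V. A x y * (f x * g y))"
    using assms by (intro tri_le_edges) (auto simp: unit_ball_def)
  also have "\<dots> \<le> 2 * (\<Sum>x\<in>V. \<Sum>y\<in>V. A x y * f x)"
    using assms by (intro mult_left_mono sum_mono mult_left_le) (auto simp: unit_ball_def)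
  also have "\<dots> = 2 * (d * (\<Sum>x\<in>V. f x))"
    by (simp add: degree sum_distrib_left flip: sum_distrib_right)
  also have "\<dots> \<le> 2 * (d * n)"
    using assms d_pos by (intro mult_left_mono) (auto simp: unit_ball_def cong: sum.cong)
  \<comment> \<open>The estimate is relaxed to the constant 98 = 2 * 49 of
    \<open>tri_le_two_thirds\<close>, so that all extreme points share one constant.\<close>
  also have "\<dots> \<le> 98 * (n * d)" using d_pos by simp
  finally show ?thesis .
qed

text \<open>Lets \<open>tri_le_one\<close> cover the origin as well.\<close>

lemma unit_ball_0_imp_1: "unit_ball 0 f \<Longrightarrow> unit_ball 1 f"
  using sum_mono[of V f "\<lambda>_. 1"] by (simp add: unit_ball_def cong: sum.cong)

lemma tri_le_two_thirds:
  assumes "unit_ball (2/3) f" "unit_ball (2/3) g" "unit_ball 0 h"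
  shows "tri f g h \<le> 98 * (n * d)"
proof -
  have "tri f g h \<le> 2 * (\<Sum>x\<in>V. \<Sum>y\<in>V. A x y * (f x * g y))"
    using assms by (intro tri_le_edges) (auto simp: unit_ball_def)
  also have "\<dots> \<le> 2 * (49 * (n * d))"
    using edges_le_three_halves[OF assms(1,2)] by linarith
  finally show ?thesis by simp
qed

lemma adm_triangleI:
  assumes "0 \<le> a1" "0 \<le> a2" "0 \<le> a3"
    and "\<And>f g h. unit_ball a1 f \<Longrightarrow> unit_ball a2 g \<Longrightarrow> unit_ball a3 h \<Longrightarrow> tri f g h \<le> 98 * (n * d)"
  shows "(a1, a2, a3, 0) \<in> adm (196 * (n * d))"
proof -
  have "quad f1 f2 f3 f4 \<le> 196 * (n * d)"
    if "unit_ball a1 f1" "unit_ball a2 f2" "unit_ball a3 f3" "unit_ball 0 f4" for f1 f2 f3 f4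
  proof -
    have "quad f1 f2 f3 f4 \<le> 2 * tri f1 f2 f3"
      using that by (intro quad_le_tri) (auto simp: unit_ball_def)
    with assms(4)[OF that(1-3)] show ?thesis by linarith
  qed
  then show ?thesis using assms(1-3) by (simp add: adm_def)
qed

lemma adm_vertices:
  defines "S \<equiv> adm (196 * (n * d))"
  shows "(0, 0, 0, 0) \<in> S" "(1, 0, 0, 0) \<in> S" "(0, 1, 0, 0) \<in> S" "(0, 0, 1, 0) \<in> S"
    "(2/3, 2/3, 0, 0) \<in> S" "(2/3, 0, 2/3, 0) \<in> S" "(0, 2/3, 2/3, 0) \<in> S"
    "(1/2, 1/2, 1/2, 0) \<in> S"
proof -
  have "tri f g h \<le> 98 * (n * d)"
    if "unit_ball (1/2) f" "unit_ball (1/2) g" "unit_ball (1/2) h" for f g h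
    using tri_le_half[OF that] d_pos by (smt (verit) mult_nonneg_nonneg of_nat_0_le_iff)
  then show "(1/2, 1/2, 1/2, 0) \<in> S"
    unfolding S_def by (intro adm_triangleI) auto
  show "(0, 0, 0, 0) \<in> S" "(1, 0, 0, 0) \<in> S"
    unfolding S_def by (auto intro!: adm_triangleI tri_le_one unit_ball_0_imp_1)
  show "(0, 1, 0, 0) \<in> S"
    unfolding S_def by (intro adm_triangleI) (simp_all, subst tri_swap12, rule tri_le_one)
  show "(0, 0, 1, 0) \<in> S"
    unfolding S_def
    by (intro adm_triangleI) (simp_all, subst tri_swap23, subst tri_swap12, rule tri_le_one)
  show "(2/3, 2/3, 0, 0) \<in> S"
    unfolding S_def by (intro adm_triangleI tri_le_two_thirds) auto
  show "(2/3, 0, 2/3, 0) \<in> S"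
    unfolding S_def by (intro adm_triangleI) (simp_all, subst tri_swap23, rule tri_le_two_thirds)
  show "(0, 2/3, 2/3, 0) \<in> S"
    unfolding S_def
    by (intro adm_triangleI) (simp_all, subst tri_swap12, subst tri_swap23, rule tri_le_two_thirds)
qed

text \<open>For each ordering of the coordinates, the inequality that doubles the largest one is the
  hypothesis of \<open>convex_flag_combination\<close>, with the unit vectors listed in decreasing
  order of their coefficients.\<close>

lemma adm_triangle_region:
  assumes "0 \<le> x" "0 \<le> y" "0 \<le> z" "2 * x + y + z \<le> 2" "x + 2 * y + z \<le> 2" "x + y + 2 * z \<le> 2"
  shows "(x, y, z, 0) \<in> adm (196 * (n * d))"
proof -
  let ?S = "adm (196 * (n * d))"
  let ?e = "(1, 0, 0, 0) :: real \<times> real \<times> real \<times> real"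
  let ?f = "(0, 1, 0, 0) :: real \<times> real \<times> real \<times> real"
  let ?g = "(0, 0, 1, 0) :: real \<times> real \<times> real \<times> real"
  have 0: "0 \<in> ?S" using adm_vertices(1) by (simp add: zero_prod_def)
  note flag = convex_flag_combination[OF convex_adm 0]
  consider "y \<le> x" "z \<le> y" | "z \<le> x" "y \<le> z" | "x \<le> y" "z \<le> x" | "z \<le> y" "x \<le> z"
    | "x \<le> z" "y \<le> x" | "y \<le> z" "x \<le> y" by linarith
  then show ?thesis
  proof cases
    case 1 then show ?thesis using flag[of ?e ?f ?g y x z] adm_vertices assms by simp
  next
    case 2 then show ?thesis using flag[of ?e ?g ?f z x y] adm_vertices assms by simp
  next
    case 3 then show ?thesis using flag[of ?f ?e ?g x y z] adm_vertices assms by simp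
  next
    case 4 then show ?thesis using flag[of ?f ?g ?e z y x] adm_vertices assms by simp
  next
    case 5 then show ?thesis using flag[of ?g ?e ?f x z y] adm_vertices assms by simp
  next
    case 6 then show ?thesis using flag[of ?g ?f ?e y z x] adm_vertices assms by simp
  qed
qed

text \<open>Only \<open>a2 + a4\<close> enters the constraints, so the point lies on the segment that joins the two
  triangle points \<open>(a1, a2 + a4, a3, 0)\<close> and \<open>(a1, 0, a3, a2 + a4)\<close>.\<close>

lemma adm_region:
  assumes "0 \<le> a1" "0 \<le> a2" "0 \<le> a3" "0 \<le> a4"
    and "a1 + a2 + 2 * a3 + a4 \<le> 2" "2 * a1 + a2 + a3 + a4 \<le> 2" "a1 + 2 * a2 + a3 + 2 * a4 \<le> 2"
  shows "(a1, a2, a3, a4) \<in> adm (196 * (n * d))"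
proof -
  let ?S = "adm (196 * (n * d))"
  have P: "(a1, a2 + a4, a3, 0) \<in> ?S" using assms by (intro adm_triangle_region) auto
  have Q: "(a1, 0, a3, a2 + a4) \<in> ?S" using adm_swap24[OF P] .
  show ?thesis
  proof (cases "a2 + a4 = 0")
    case True
    then have "a2 = 0" "a4 = 0" using assms by auto
    then show ?thesis using P by simp
  next
    case False
    define s where "s = a4 / (a2 + a4)"
    have s: "0 \<le> s" "s \<le> 1" "s * (a2 + a4) = a4" "(1 - s) * (a2 + a4) = a2"
      using False assms by (auto simp: s_def field_simps)
    have "(1 - s) *\<^sub>R (a1, a2 + a4, a3, 0) + s *\<^sub>R (a1, 0, a3, a2 + a4) \<in> ?S"
      using convex_adm[of "196 * (n * d)"] P Q s(1,2) by (simp add: convex_alt del: scaleR_Pair)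
    moreover have "(1 - s) *\<^sub>R (a1, a2 + a4, a3, 0) + s *\<^sub>R (a1, 0, a3, a2 + a4) = (a1, a2, a3, a4)"
      using s(3,4) by (simp add: algebra_simps)
    ultimately show ?thesis by simp
  qed
qed

end

section \<open>Circles in the plane over a finite field\<close>

lemma (in ring) nat_pow_2: "x \<in> carrier R \<Longrightarrow> x [^] (2::nat) = x \<otimes> x"
  by (simp add: numeral_2_eq_2)

lemma (in ring) qnorm_eq:
  "x \<in> plane R \<Longrightarrow> qnorm R x = fst x \<otimes> fst x \<oplus> snd x \<otimes> snd x"
  by (auto simp: qnorm_def plane_def nat_pow_2)

lemma (in ring) qnorm_closed [simp]: "x \<in> plane R \<Longrightarrow> qnorm R x \<in> carrier R"
  by (auto simp: qnorm_eq plane_def)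

lemma (in ring) vdiff_closed [simp]: "x \<in> plane R \<Longrightarrow> y \<in> plane R \<Longrightarrow> vdiff R x y \<in> plane R"
  by (auto simp: vdiff_def plane_def)

lemma (in cring) qnorm_vdiff_commute:
  assumes "x \<in> plane R" "y \<in> plane R"
  shows "qnorm R (vdiff R x y) = qnorm R (vdiff R y x)"
proof -
  obtain a b c e where x: "x = (a, b)" "y = (c, e)" by (metis surj_pair)
  have c: "a \<in> carrier R" "b \<in> carrier R" "c \<in> carrier R" "e \<in> carrier R"
    using assms by (auto simp: x plane_def)
  show ?thesis using assms by (simp add: qnorm_eq) (use c in \<open>simp add: vdiff_def x, algebra\<close>)
qed

text \<open>The map sending \<open>y\<close> to \<open>x - y\<close> is an involution.\<close>

lemma (in ring) bij_betw_vdiff: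
  assumes "x \<in> plane R"
  shows "bij_betw (vdiff R x) (plane R) (plane R)"
proof (rule bij_betwI[where g = "vdiff R x"])
  have *: "a \<ominus> (a \<ominus> b) = b" if "a \<in> carrier R" "b \<in> carrier R" for a b
    using that by (simp add: minus_eq minus_add a_assoc[symmetric] r_neg)
  show "vdiff R x (vdiff R x y) = y" if "y \<in> plane R" for y
    using that assms * by (cases y) (auto simp: vdiff_def plane_def)
  then show "vdiff R x (vdiff R x y) = y" if "y \<in> plane R" for y using that .
qed (use assms in auto)

section \<open>Intersections of two circles\<close>

lemma (in domain) card_square_roots_le:
  assumes "finite (carrier R)"
  shows "card {x \<in> carrier R. x \<otimes> x = c} \<le> 2"
proof (cases "{x \<in> carrier R. x \<otimes> x = c} = {}")
  case False
  then obtain a where a: "a \<in> carrier R" "a \<otimes> a = c" by auto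
  have "{x \<in> carrier R. x \<otimes> x = c} \<subseteq> {a, \<ominus> a}"
  proof (intro subsetI CollectI, elim CollectE conjE)
    fix x assume x: "x \<in> carrier R" "x \<otimes> x = c"
    have "(x \<ominus> a) \<otimes> (x \<oplus> a) = x \<otimes> x \<ominus> a \<otimes> a"
      using x(1) a(1) by algebra
    then have "(x \<ominus> a) \<otimes> (x \<oplus> a) = \<zero>" using x a by (metis m_closed r_right_minus_eq)
    then have "x \<ominus> a = \<zero> \<or> x \<oplus> a = \<zero>"
      using x(1) a(1) by (simp add: integral_iff)
    then show "x \<in> {a, \<ominus> a}"
      using x(1) a(1) minus_equality r_right_minus_eq by (metis insertI1 insertI2)
  qed
  then have "card {x \<in> carrier R. x \<otimes> x = c} \<le> card {a, \<ominus> a}" by (intro card_mono) auto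
  also have "\<dots> \<le> 2" by (simp add: card_insert_if)
  finally show ?thesis .
next
  case True
  then show ?thesis by (simp only: card.empty)
qed

text \<open>Otherwise 1 has additive order 2, which by Lagrange's theorem divides the odd order of
  the additive group.\<close>

lemma (in domain) two_neq_zero:
  assumes "finite (carrier R)" "odd (card (carrier R))"
  shows "\<one> \<oplus> \<one> \<noteq> \<zero>"
proof
  assume *: "\<one> \<oplus> \<one> = \<zero>"
  have "add.ord \<one> dvd 2"
    using * by (intro add.pow_eq_id[THEN iffD1]) (simp_all add: numeral_2_eq_2)
  moreover have "add.ord \<one> dvd order (add_monoid R)"
    using assms by (intro add.ord_dvd_group_order) auto
  moreover have "add.ord \<one> \<noteq> 1" using add.ord_eq_1[of \<one>] one_not_zero by simp
  ultimately show False
    using assms(2) by (metis order_def partial_object.select_convs(1) prime_nat_iff two_is_prime_nat dvd_def)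
qed

lemma (in ring) mem_circle_iff:
  "(x, y) \<in> circle R s \<longleftrightarrow> x \<in> carrier R \<and> y \<in> carrier R \<and> x \<otimes> x \<oplus> y \<otimes> y = s"
  by (auto simp: circle_def qnorm_eq) (auto simp: plane_def qnorm_eq)

text \<open>Subtracting the two circle equations fixes the dot product of \<open>w\<close> with
  \<open>v\<close>. The cross product then has a prescribed square, so it takes at most two values,
  and the two products together determine \<open>w\<close> as long as the norm \<open>m\<close> of
  \<open>v\<close> is nonzero.\<close>

lemma (in domain) card_circle_inter_le:
  assumes fin: "finite (carrier R)" and odd: "odd (card (carrier R))"
    and t: "t \<noteq> \<zero>" and v: "v \<in> plane R" "v \<noteq> (\<zero>, \<zero>)"
  shows "card {w \<in> plane R. qnorm R w = t \<and> qnorm R (vdiff R w v) = t} \<le> 2"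
proof -
  let ?S = "{w \<in> plane R. qnorm R w = t \<and> qnorm R (vdiff R w v) = t}"
  obtain c e where ce: "v = (c, e)" "c \<in> carrier R" "e \<in> carrier R"
    using v by (auto simp: plane_def)
  define u where "u = \<one> \<oplus> \<one>"
  have u: "u \<in> carrier R" "u \<noteq> \<zero>" using two_neq_zero[OF fin odd] by (auto simp: u_def)
  define m where "m = c \<otimes> c \<oplus> e \<otimes> e"
  have m: "m \<in> carrier R" using ce by (simp add: m_def)
  have S: "a \<in> carrier R" "b \<in> carrier R" "a \<otimes> a \<oplus> b \<otimes> b = t"
      "u \<otimes> (a \<otimes> c \<oplus> b \<otimes> e) = m" if "(a, b) \<in> ?S" for a b
  proof -
    show ab: "a \<in> carrier R" "b \<in> carrier R" using that by (auto simp: plane_def)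
    show 1: "a \<otimes> a \<oplus> b \<otimes> b = t" using that by (auto simp: qnorm_eq)
    have "(a, b) \<in> plane R" "vdiff R (a, b) v \<in> plane R" using that v by auto
    then have 2: "(a \<ominus> c) \<otimes> (a \<ominus> c) \<oplus> (b \<ominus> e) \<otimes> (b \<ominus> e) = t"
      using that by (simp add: qnorm_eq vdiff_def ce)
    have "u \<otimes> (a \<otimes> c \<oplus> b \<otimes> e) = m \<oplus> ((a \<otimes> a \<oplus> b \<otimes> b) \<ominus>
        ((a \<ominus> c) \<otimes> (a \<ominus> c) \<oplus> (b \<ominus> e) \<otimes> (b \<ominus> e)))"
      using ab ce(2,3) unfolding u_def m_def by algebra
    also have "\<dots> = m \<oplus> (t \<ominus> t)" unfolding 1 2 ..
    also have "\<dots> = m" using m 1 ab by (metis add.r_one m_closed r_right_minus_eq a_closed)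
    finally show "u \<otimes> (a \<otimes> c \<oplus> b \<otimes> e) = m" .
  qed
  define \<chi> where "\<chi> w = u \<otimes> (fst w \<otimes> e \<ominus> snd w \<otimes> c)" for w
  show ?thesis
  proof (cases "m = \<zero>")
    \<comment> \<open>A nonzero \<open>v\<close> may be isotropic. Then its dot product with
      \<open>w\<close> vanishes too, and the identities below force \<open>c = e = \<zero>\<close>
      because \<open>t\<close> is nonzero; hence the circles are disjoint.\<close>
    case True
    have "?S = {}"
    proof (rule equals0I)
      fix w assume w: "w \<in> ?S"
      obtain a b where ab: "w = (a, b)" by (cases w)
      note S' = S[OF w[unfolded ab]]
      have "(u \<otimes> c) \<otimes> (u \<otimes> c) \<otimes> (a \<otimes> a \<oplus> b \<otimes> b) =
          (u \<otimes> (a \<otimes> c \<oplus> b \<otimes> e)) \<otimes>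
            (u \<otimes> (a \<otimes> c \<oplus> b \<otimes> e) \<ominus> (u \<otimes> b \<otimes> e \<oplus> u \<otimes> b \<otimes> e)) \<oplus> u \<otimes> u \<otimes> b \<otimes> b \<otimes> m"
        using S'(1,2) ce(2,3) u(1) unfolding m_def by algebra
      then have "(u \<otimes> c) \<otimes> (u \<otimes> c) \<otimes> t = \<zero>"
        unfolding S'(3,4) True using S'(1,2) ce(2,3) u(1) by simp
      then have c0: "c = \<zero>" using u t ce S'(1-3) by (metis a_closed integral_iff m_closed)
      have "(u \<otimes> e) \<otimes> (u \<otimes> e) \<otimes> (a \<otimes> a \<oplus> b \<otimes> b) =
          (u \<otimes> (a \<otimes> c \<oplus> b \<otimes> e)) \<otimes>
            (u \<otimes> (a \<otimes> c \<oplus> b \<otimes> e) \<ominus> (u \<otimes> a \<otimes> c \<oplus> u \<otimes> a \<otimes> c)) \<oplus> u \<otimes> u \<otimes> a \<otimes> a \<otimes> m"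
        using S'(1,2) ce(2,3) u(1) unfolding m_def by algebra
      then have "(u \<otimes> e) \<otimes> (u \<otimes> e) \<otimes> t = \<zero>"
        unfolding S'(3,4) True using S'(1,2) ce(2,3) u(1) by simp
      then have "e = \<zero>" using u t ce S'(1-3) by (metis a_closed integral_iff m_closed)
      with c0 v ce show False by simp
    qed
    then show ?thesis by (simp only: card.empty)
  next
    case False
    have cancel: "x = y" if "u \<otimes> x \<otimes> m = u \<otimes> y \<otimes> m" "x \<in> carrier R" "y \<in> carrier R" for x y
      using that u m False by (metis m_closed m_lcancel m_rcancel)
    have "inj_on \<chi> ?S"
    proof (rule inj_onI)
      fix w w' assume w: "w \<in> ?S" "w' \<in> ?S" and eq: "\<chi> w = \<chi> w'"
      \<comment> \<open>Expansion of \<open>z\<close> in the orthogonal vectors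
        \<open>(c, e)\<close> and \<open>(e, -c)\<close>, whose common norm is \<open>m\<close>; the
        coefficients are the dot and the cross product.\<close>
      have first: "u \<otimes> fst z \<otimes> m = m \<otimes> c \<oplus> \<chi> z \<otimes> e"
        and second: "u \<otimes> snd z \<otimes> m = m \<otimes> e \<ominus> \<chi> z \<otimes> c" if z: "z \<in> ?S" for z
      proof -
        obtain a b where ab: "z = (a, b)" by (cases z)
        note S' = S[OF z[unfolded ab]]
        have "u \<otimes> a \<otimes> m = (u \<otimes> (a \<otimes> c \<oplus> b \<otimes> e)) \<otimes> c \<oplus> u \<otimes> (a \<otimes> e \<ominus> b \<otimes> c) \<otimes> e"
          using S'(1,2) ce(2,3) u(1) unfolding m_def by algebra
        then show "u \<otimes> fst z \<otimes> m = m \<otimes> c \<oplus> \<chi> z \<otimes> e" unfolding S'(4) by (simp add: ab \<chi>_def)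
        have "u \<otimes> b \<otimes> m = (u \<otimes> (a \<otimes> c \<oplus> b \<otimes> e)) \<otimes> e \<ominus> u \<otimes> (a \<otimes> e \<ominus> b \<otimes> c) \<otimes> c"
          using S'(1,2) ce(2,3) u(1) unfolding m_def by algebra
        then show "u \<otimes> snd z \<otimes> m = m \<otimes> e \<ominus> \<chi> z \<otimes> c" unfolding S'(4) by (simp add: ab \<chi>_def)
      qed
      have "fst w = fst w'" "snd w = snd w'"
        by (rule cancel; use w eq first[OF w(1)] first[OF w(2)] second[OF w(1)] second[OF w(2)] in
            \<open>auto simp: plane_def\<close>)+
      then show "w = w'" by (rule prod_eqI)
    qed
    moreover have "\<chi> ` ?S \<subseteq> {x \<in> carrier R. x \<otimes> x = u \<otimes> u \<otimes> t \<otimes> m \<ominus> m \<otimes> m}"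
    proof
      fix x assume "x \<in> \<chi> ` ?S"
      then obtain a b where x: "x = \<chi> (a, b)" and ab: "(a, b) \<in> ?S" by auto
      note S' = S[OF ab]
      \<comment> \<open>Lagrange's identity: the squares of the dot and the cross product add up to
        the product of the norms.\<close>
      have "(u \<otimes> (a \<otimes> e \<ominus> b \<otimes> c)) \<otimes> (u \<otimes> (a \<otimes> e \<ominus> b \<otimes> c)) = u \<otimes> u \<otimes> (a \<otimes> a \<oplus> b \<otimes> b) \<otimes> m \<ominus>
          (u \<otimes> (a \<otimes> c \<oplus> b \<otimes> e)) \<otimes> (u \<otimes> (a \<otimes> c \<oplus> b \<otimes> e))"
        using S'(1,2) ce(2,3) u(1) unfolding m_def by algebra
      then have "x \<otimes> x = u \<otimes> u \<otimes> t \<otimes> m \<ominus> m \<otimes> m"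
        unfolding S'(3,4) by (simp add: x \<chi>_def)
      then show "x \<in> {x \<in> carrier R. x \<otimes> x = u \<otimes> u \<otimes> t \<otimes> m \<ominus> m \<otimes> m}"
        using S'(1,2) u ce by (simp add: x \<chi>_def)
    qed
    ultimately have "card ?S \<le> card {x \<in> carrier R. x \<otimes> x = u \<otimes> u \<otimes> t \<otimes> m \<ominus> m \<otimes> m}"
      using fin by (intro card_inj_on_le) auto
    also have "\<dots> \<le> 2" by (rule card_square_roots_le[OF fin])
    finally show ?thesis .
  qed
qed

section \<open>Sizes of circles\<close>

lemma (in domain) card_circle_le:
  assumes "finite (carrier R)" "s \<in> carrier R"
  shows "card (circle R s) \<le> 2 * card (carrier R)"
proof -
  let ?T = "SIGMA x:carrier R. {y \<in> carrier R. y \<otimes> y = s \<ominus> x \<otimes> x}"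
  have "circle R s \<subseteq> ?T"
  proof
    fix w assume "w \<in> circle R s"
    then obtain x y where w: "w = (x, y)" "x \<in> carrier R" "y \<in> carrier R" "x \<otimes> x \<oplus> y \<otimes> y = s"
      by (cases w) (auto simp only: mem_circle_iff)
    have "y \<otimes> y = (x \<otimes> x \<oplus> y \<otimes> y) \<ominus> x \<otimes> x" using w(2,3) by algebra
    then show "w \<in> ?T" using w by simp
  qed
  then have "card (circle R s) \<le> card ?T" using assms by (intro card_mono) auto
  also have "\<dots> = (\<Sum>x\<in>carrier R. card {y \<in> carrier R. y \<otimes> y = s \<ominus> x \<otimes> x})"
    using assms by (intro card_SigmaI) auto
  also have "\<dots> \<le> (\<Sum>x\<in>carrier R. 2)"
    by (intro sum_mono card_square_roots_le assms)
  finally show ?thesis by (simp add: mult.commute)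
qed

text \<open>Pigeonhole: the set \<open>Q\<close> of squares has at least half of the elements, and
  strictly more than half since their number is odd. So \<open>Q\<close> meets its reflection under
  \<open>s\<close> to \<open>t - s\<close>.\<close>

lemma (in domain) circle_nonempty:
  assumes "finite (carrier R)" "odd (card (carrier R))" "t \<in> carrier R"
  obtains z where "z \<in> circle R t"
proof -
  define Q where "Q = (\<lambda>x. x \<otimes> x) ` carrier R"
  have Q: "finite Q" "Q \<subseteq> carrier R" using assms by (auto simp: Q_def)
  have inj: "inj_on (\<lambda>s. t \<ominus> s) Q"
  proof (rule inj_onI)
    fix x y assume "x \<in> Q" "y \<in> Q" "t \<ominus> x = t \<ominus> y"
    moreover have "z = t \<ominus> (t \<ominus> z)" if "z \<in> carrier R" for z
      using that assms(3) by algebra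
    ultimately show "x = y" using Q(2) by (metis subsetD)
  qed
  have "card (carrier R) = (\<Sum>x\<in>carrier R. 1)" by simp
  also have "\<dots> = (\<Sum>c\<in>Q. \<Sum>x\<in>{x \<in> carrier R. x \<otimes> x = c}. 1)"
    unfolding Q_def by (rule sum.image_gen[OF assms(1)])
  also have "\<dots> \<le> (\<Sum>c\<in>Q. 2)"
    using card_square_roots_le[OF assms(1)] by (intro sum_mono) simp
  finally have le: "card (carrier R) \<le> 2 * card Q" by simp
  have "Q \<inter> (\<lambda>s. t \<ominus> s) ` Q \<noteq> {}"
  proof
    assume "Q \<inter> (\<lambda>s. t \<ominus> s) ` Q = {}"
    then have "card (Q \<union> (\<lambda>s. t \<ominus> s) ` Q) = 2 * card Q"
      using Q(1) inj by (simp add: card_Un_disjoint card_image)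
    moreover have "card (Q \<union> (\<lambda>s. t \<ominus> s) ` Q) \<le> card (carrier R)"
      using Q assms by (intro card_mono) auto
    ultimately have "card (carrier R) = 2 * card Q" using le by simp
    with assms(2) show False by simp
  qed
  then obtain x y where xy: "x \<in> carrier R" "y \<in> carrier R" "x \<otimes> x = t \<ominus> y \<otimes> y"
    by (auto simp: Q_def)
  have "t = (t \<ominus> y \<otimes> y) \<oplus> y \<otimes> y" using xy(2) assms(3) by algebra
  then have "(x, y) \<in> circle R t" using xy by (simp add: mem_circle_iff)
  then show ?thesis by (rule that)
qed

text \<open>Multiplication by a point of norm \<open>t/s\<close>, as for complex numbers, injects one circle into the other.\<close>

lemma (in field) card_circle_mono:
  assumes fin: "finite (carrier R)" and odd: "odd (card (carrier R))"
    and s: "s \<in> carrier R" "s \<noteq> \<zero>" and t: "t \<in> carrier R" "t \<noteq> \<zero>"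
  shows "card (circle R s) \<le> card (circle R t)"
proof -
  have iv: "inv s \<in> carrier R" "s \<otimes> inv s = \<one>" "inv s \<noteq> \<zero>"
    using s field_Units by auto
  obtain z where z: "z \<in> circle R (t \<otimes> inv s)"
    using circle_nonempty[OF fin odd, of "t \<otimes> inv s"] t iv by auto
  then obtain a b where ab: "a \<in> carrier R" "b \<in> carrier R" "a \<otimes> a \<oplus> b \<otimes> b = t \<otimes> inv s"
    by (cases z) (auto simp only: mem_circle_iff)
  define \<mu> where "\<mu> w = (a \<otimes> fst w \<ominus> b \<otimes> snd w, a \<otimes> snd w \<oplus> b \<otimes> fst w)" for w
  have nz: "t \<otimes> inv s \<noteq> \<zero>" using t iv by (simp add: integral_iff)
  have "inj_on \<mu> (plane R)"
  proof (rule inj_onI)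
    fix w w' assume w: "w \<in> plane R" "w' \<in> plane R" and eq: "\<mu> w = \<mu> w'"
    \<comment> \<open>Multiplication by the conjugate \<open>(a, -b)\<close> undoes
      \<open>\<mu>\<close> up to the nonzero factor \<open>t / s\<close>.\<close>
    have recover: "fst x \<otimes> (t \<otimes> inv s) = a \<otimes> fst (\<mu> x) \<oplus> b \<otimes> snd (\<mu> x)"
      "snd x \<otimes> (t \<otimes> inv s) = a \<otimes> snd (\<mu> x) \<ominus> b \<otimes> fst (\<mu> x)" if "x \<in> plane R" for x
    proof -
      have x: "fst x \<in> carrier R" "snd x \<in> carrier R" using that by (auto simp: plane_def)
      show "fst x \<otimes> (t \<otimes> inv s) = a \<otimes> fst (\<mu> x) \<oplus> b \<otimes> snd (\<mu> x)"
        unfolding ab(3)[symmetric] \<mu>_def fst_conv snd_conv using ab(1,2) x by algebra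
      show "snd x \<otimes> (t \<otimes> inv s) = a \<otimes> snd (\<mu> x) \<ominus> b \<otimes> fst (\<mu> x)"
        unfolding ab(3)[symmetric] \<mu>_def fst_conv snd_conv using ab(1,2) x by algebra
    qed
    have "fst w \<otimes> (t \<otimes> inv s) = fst w' \<otimes> (t \<otimes> inv s)" "snd w \<otimes> (t \<otimes> inv s) = snd w' \<otimes> (t \<otimes> inv s)"
      using recover[OF w(1)] recover[OF w(2)] eq by auto
    then have "fst w = fst w'" "snd w = snd w'"
      using w nz t iv by (auto simp: plane_def m_rcancel)
    then show "w = w'" by (rule prod_eqI)
  qed
  then have "inj_on \<mu> (circle R s)" by (rule inj_on_subset) (auto simp: circle_def)
  moreover have "\<mu> ` circle R s \<subseteq> circle R t"
  proof
    fix x assume "x \<in> \<mu> ` circle R s"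
    then obtain c e where x: "x = \<mu> (c, e)" and ce: "c \<in> carrier R" "e \<in> carrier R" "c \<otimes> c \<oplus> e \<otimes> e = s"
      by (auto simp only: mem_circle_iff)
    have pl: "x \<in> plane R" using ab ce by (simp add: x \<mu>_def plane_def)
    \<comment> \<open>Multiplicativity of the norm, that is, Brahmagupta's identity.\<close>
    have "(a \<otimes> c \<ominus> b \<otimes> e) \<otimes> (a \<otimes> c \<ominus> b \<otimes> e) \<oplus> (a \<otimes> e \<oplus> b \<otimes> c) \<otimes> (a \<otimes> e \<oplus> b \<otimes> c) =
        (a \<otimes> a \<oplus> b \<otimes> b) \<otimes> (c \<otimes> c \<oplus> e \<otimes> e)"
      using ab(1,2) ce(1,2) by algebra
    also have "\<dots> = t \<otimes> (s \<otimes> inv s)" unfolding ab(3) ce(3) using t s iv(1) by algebra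
    also have "\<dots> = t" using t iv by simp
    finally have "qnorm R x = t" by (simp add: qnorm_eq[OF pl]) (simp add: x \<mu>_def)
    with pl show "x \<in> circle R t" by (simp add: circle_def)
  qed
  moreover have "finite (circle R t)" using fin by (simp add: circle_def plane_def)
  ultimately show ?thesis by (rule card_inj_on_le)
qed

text \<open>The circles partition the plane. If the one of radius \<open>t\<close> were small, then
  so would be all circles of nonzero radius, by \<open>card_circle_mono\<close>, and they could not
  exhaust \<open>q * q\<close> points.\<close>

lemma (in field) card_circle_ge:
  assumes fin: "finite (carrier R)" and odd: "odd (card (carrier R))"
    and t: "t \<in> carrier R" "t \<noteq> \<zero>"
  shows "card (carrier R) \<le> 2 * card (circle R t)"
proof (rule ccontr)
  define q where "q = card (carrier R)"
  define d where "d = card (circle R t)"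
  assume "\<not> ?thesis"
  then have d: "2 * d \<le> q - 1" by (simp add: d_def q_def)
  have "card {\<zero>, \<one>} \<le> q" unfolding q_def using fin by (intro card_mono) auto
  then have "2 \<le> q" using one_not_zero by simp
  then have q3: "3 \<le> q" using odd by (cases "q = 2") (auto simp: q_def)
  have "q * q = (\<Sum>x\<in>plane R. 1)" by (simp add: plane_def q_def card_cartesian_product)
  also have "\<dots> = (\<Sum>s\<in>carrier R. \<Sum>x\<in>{x \<in> plane R. qnorm R x = s}. 1)"
    using fin by (intro sum.group[symmetric]) (auto simp: plane_def[of R])
  also have "\<dots> = (\<Sum>s\<in>carrier R. card (circle R s))" by (simp add: circle_def)
  also have "\<dots> = card (circle R \<zero>) + (\<Sum>s\<in>carrier R - {\<zero>}. card (circle R s))"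
    using fin by (intro sum.remove) auto
  \<comment> \<open>The circle of radius 0 is outside the scope of \<open>card_circle_mono\<close>
    and is bounded separately, by two points for each first coordinate.\<close>
  also have "\<dots> \<le> 2 * q + (\<Sum>s\<in>carrier R - {\<zero>}. d)"
    unfolding q_def d_def using t
    by (intro add_mono sum_mono card_circle_le card_circle_mono fin odd) auto
  also have "\<dots> = 2 * q + (q - 1) * d" using fin by (simp add: q_def)
  finally have "2 * (q * q) \<le> 4 * q + (q - 1) * (2 * d)" by simp
  also have "\<dots> \<le> 4 * q + (q - 1) * (q - 1)" using d by (intro add_left_mono mult_left_mono) auto
  finally have "2 * (q * q) \<le> 4 * q + (q - 1) * (q - 1)" .
  \<comment> \<open>The substitution removes the truncated subtraction in \<open>q - 1\<close>; the
    quadratic inequality fails from \<open>q = 3\<close> on.\<close>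
  moreover obtain r where "q = r + 3" using q3 by (metis add.commute le_Suc_ex)
  ultimately show False by (simp add: algebra_simps)
qed

section \<open>From the graph to the operator\<close>

lemma adm_field_odd: "adm_field R \<Longrightarrow> odd (card (carrier R))"
  by (auto simp: adm_field_def)

text \<open>Substituting \<open>w = x - z\<close> turns the neighbours of \<open>x\<close> into the
  circle around 0, and the common neighbours of \<open>x\<close> and \<open>y\<close> into the
  intersection of the circles around 0 and \<open>x - y\<close>. The density condition is the square
  of \<open>card_circle_ge\<close>.\<close>

lemma sparse_graph_circle:
  fixes R (structure)
  assumes "adm_field R" "t \<in> carrier R - {\<zero>\<^bsub>R\<^esub>}"
  shows "sparse_graph (plane R) (\<lambda>x y. indicator (circle R t) (vdiff R x y)) (card (circle R t))"
proof -
  interpret field R using assms by (simp add: adm_field_def)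
  have fin: "finite (carrier R)" using assms by (simp add: adm_field_def)
  have odd: "odd (card (carrier R))" using assms by (simp add: adm_field_odd)
  have t: "t \<in> carrier R" "t \<noteq> \<zero>" using assms by auto
  have ge: "card (carrier R) \<le> 2 * card (circle R t)" using fin odd t by (rule card_circle_ge)
  have pos: "0 < card (carrier R)" using fin carrier_not_empty by (simp add: card_gt_0_iff)
  have finV: "finite (plane R)" using fin by (simp add: plane_def)
  show ?thesis
  proof
    show "finite (plane R)" by fact
    show "indicator (circle R t) (vdiff R x y) \<in> {0, 1 :: real}" for x y
      by (simp add: indicator_def)
    show "(indicator (circle R t) (vdiff R x y) :: real) = indicator (circle R t) (vdiff R y x)"
      if "x \<in> plane R" "y \<in> plane R" for x y
      using that by (simp add: indicator_def circle_def qnorm_vdiff_commute)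
    show "(indicator (circle R t) (vdiff R x x) :: real) = 0" if "x \<in> plane R" for x
    proof -
      have "vdiff R x x = (\<zero>, \<zero>)" using that by (auto simp: vdiff_def plane_def minus_eq r_neg)
      then show ?thesis using t by (simp add: mem_circle_iff)
    qed
    show "(\<Sum>y\<in>plane R. indicator (circle R t) (vdiff R x y)) = real (card (circle R t))"
      if "x \<in> plane R" for x
    proof -
      have "(\<Sum>y\<in>plane R. indicator (circle R t) (vdiff R x y)) =
          (\<Sum>w\<in>plane R. indicator (circle R t) w :: real)"
        using bij_betw_vdiff[OF that] by (rule sum.reindex_bij_betw)
      also have "\<dots> = real (card (plane R \<inter> circle R t))"
        using finV by (simp add: indicator_def Int_def)
      also have "plane R \<inter> circle R t = circle R t" by (auto simp: circle_def)
      finally show ?thesis .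
    qed
    show "(\<Sum>z\<in>plane R. indicator (circle R t) (vdiff R x z) *
        indicator (circle R t) (vdiff R y z)) \<le> (2 :: real)"
      if xy: "x \<in> plane R" "y \<in> plane R" "x \<noteq> y" for x y
    proof -
      let ?Z = "{z \<in> plane R. vdiff R x z \<in> circle R t \<and> vdiff R y z \<in> circle R t}"
      let ?W = "{w \<in> plane R. qnorm R w = t \<and> qnorm R (vdiff R w (vdiff R x y)) = t}"
      have "vdiff R (vdiff R x z) (vdiff R x y) = vdiff R y z" if "z \<in> plane R" for z
      proof -
        have "(a \<ominus> c) \<ominus> (a \<ominus> b) = b \<ominus> c"
          if "a \<in> carrier R" "b \<in> carrier R" "c \<in> carrier R" for a b c
          using that by algebra
        then show ?thesis using that xy(1,2) by (auto simp: vdiff_def plane_def)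
      qed
      then have "vdiff R x ` ?Z \<subseteq> ?W" using xy by (auto simp: circle_def)
      moreover have "inj_on (vdiff R x) ?Z"
        by (rule inj_on_subset[OF bij_betw_imp_inj_on[OF bij_betw_vdiff[OF xy(1)]]]) auto
      moreover have "finite ?W" using finV by simp
      ultimately have "card ?Z \<le> card ?W" by (intro card_inj_on_le)
      also have "\<dots> \<le> 2"
      proof (rule card_circle_inter_le[OF fin odd t(2)])
        show "vdiff R x y \<noteq> (\<zero>, \<zero>)" using xy by (auto simp: vdiff_def plane_def)
      qed (use xy in simp)
      finally have "card ?Z \<le> 2" .
      moreover have "(\<Sum>z\<in>plane R. indicator (circle R t) (vdiff R x z) *
          indicator (circle R t) (vdiff R y z)) =
          (\<Sum>z\<in>plane R. if vdiff R x z \<in> circle R t \<and> vdiff R y z \<in> circle R t then 1 else 0 :: real)"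
        by (intro sum.cong) (auto simp: indicator_def)
      moreover have "\<dots> = real (card ?Z)" using finV by (simp add: sum.If_cases Int_def)
      ultimately show ?thesis by simp
    qed
    show "0 < real (card (circle R t))" using ge pos by simp
    have "real (card (carrier R)) * real (card (carrier R)) \<le>
        (2 * real (card (circle R t))) * (2 * real (card (circle R t)))"
      using ge by (intro mult_mono) auto
    then show "real (card (plane R)) \<le> 4 * (real (card (circle R t)))\<^sup>2"
      by (simp add: plane_def card_cartesian_product power2_eq_square)
  qed
qed

section \<open>Normalisation by homogeneity and extended real exponents\<close>

lemma (in sparse_graph) quad_scale:
  "quad (\<lambda>x. f1 x / c1) (\<lambda>x. f2 x / c2) (\<lambda>x. f3 x / c3) (\<lambda>x. f4 x / c4) =
    quad f1 f2 f3 f4 / (c1 * c2 * c3 * c4)"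
  unfolding quad_def by (simp add: sum_divide_distrib)

definition recip :: "ereal \<Rightarrow> real" where
  "recip p = (if p = \<infinity> then 0 else 1 / real_of_ereal p)"

lemma recip_props:
  assumes "1 \<le> p"
  shows "0 \<le> recip p" "1 / p = ereal (recip p)" "2 / p = ereal (2 * recip p)"
proof -
  have "0 \<le> recip p \<and> 1 / p = ereal (recip p) \<and> 2 / p = ereal (2 * recip p)"
  proof (cases p)
    case (real r)
    with assms have "1 \<le> r" by simp
    then show ?thesis unfolding real one_ereal_def numeral_eq_ereal by (simp add: recip_def)
  qed (use assms in \<open>simp_all add: recip_def\<close>)
  then show "0 \<le> recip p" "1 / p = ereal (recip p)" "2 / p = ereal (2 * recip p)" by auto
qed

text \<open>The divisor \<open>c\<close> may exceed the norm, because the norm itself can be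
  0.\<close>

lemma unit_ball_Lp_norm:
  assumes graph: "sparse_graph (plane R) A d"
    and "1 \<le> p" and f: "\<And>x. x \<in> plane R \<Longrightarrow> 0 \<le> f x" and c: "0 < c" "Lp_norm R p f \<le> c"
  shows "sparse_graph.unit_ball (plane R) (recip p) (\<lambda>x. f x / c)"
proof (cases "p = \<infinity>")
  case True
  have fin: "finite (plane R)" using graph by (simp add: sparse_graph_def)
  have "f x \<le> c" if x: "x \<in> plane R" for x
  proof -
    have "\<bar>f x\<bar> \<le> Max ((\<lambda>x. \<bar>f x\<bar>) ` plane R)" using fin x by (intro Max_ge) auto
    then show ?thesis using c True by (simp add: Lp_norm_def)
  qed
  then show ?thesis using f c True by (simp add: sparse_graph.unit_ball_def[OF graph] recip_def)
next
  case False
  then obtain r where r: "p = ereal r" "1 \<le> r" using assms(2) by (cases p) auto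
  define S where "S = (\<Sum>x\<in>plane R. \<bar>f x\<bar> powr r)"
  have n: "real (card (plane R)) = real (card (carrier R)) ^ 2"
    by (simp add: plane_def card_cartesian_product power2_eq_square)
  have S0: "0 \<le> S" by (simp add: S_def sum_nonneg)
  have "(S / real (card (plane R))) powr (1 / r) \<le> c"
    using c(2) r by (simp add: Lp_norm_def S_def n)
  then have "((S / real (card (plane R))) powr (1 / r)) powr r \<le> c powr r"
    using r by (intro powr_mono2) auto
  then have *: "S / real (card (plane R)) \<le> c powr r"
    using S0 r by (simp add: powr_powr)
  have "S \<le> c powr r * real (card (plane R))"
  proof (cases "card (plane R) = 0")
    case True
    have "finite (plane R)" using graph by (simp add: sparse_graph_def)
    then show ?thesis using True by (simp add: S_def)
  next
    case False
    then show ?thesis using * by (simp add: field_simps)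
  qed
  moreover have "(\<Sum>x\<in>plane R. (f x / c) powr r) = S / c powr r"
    unfolding S_def sum_divide_distrib using f c by (intro sum.cong) (auto simp: powr_divide)
  ultimately have "(\<Sum>x\<in>plane R. (f x / c) powr r) \<le> real (card (plane R))"
    using c(1) by (simp add: pos_divide_le_eq mult.commute)
  then show ?thesis using f c r by (simp add: sparse_graph.unit_ball_def[OF graph] recip_def)
qed

lemma diamond_bound_region:
  assumes "adm_field R" "t \<in> carrier R - {\<zero>\<^bsub>R\<^esub>}"
    and p: "1 \<le> p1" "1 \<le> p2" "1 \<le> p3" "1 \<le> p4"
    and region: "1 / p1 + 1 / p2 + 2 / p3 + 1 / p4 \<le> 2" "2 / p1 + 1 / p2 + 1 / p3 + 1 / p4 \<le> 2"
      "1 / p1 + 2 / p2 + 1 / p3 + 2 / p4 \<le> 2"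
  shows "diamond_bound R t p1 p2 p3 p4 196"
  unfolding diamond_bound_def
proof (intro allI impI)
  fix f1 f2 f3 f4 :: "'a \<times> 'a \<Rightarrow> real"
  assume nn: "\<forall>x\<in>plane R. 0 \<le> f1 x \<and> 0 \<le> f2 x \<and> 0 \<le> f3 x \<and> 0 \<le> f4 x"
  let ?A = "\<lambda>x y. indicator (circle R t) (vdiff R x y) :: real"
  let ?d = "real (card (circle R t))"
  have graph: "sparse_graph (plane R) ?A ?d" using assms(1,2) by (rule sparse_graph_circle)
  then interpret sparse_graph "plane R" ?A ?d .
  have fin: "finite (plane R)" by (rule finite_V)
  have ne: "plane R \<noteq> {}"
    using assms(2) by (auto simp: plane_def)
  define N1 N2 N3 N4 where "N1 = Lp_norm R p1 f1" and "N2 = Lp_norm R p2 f2"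
    and "N3 = Lp_norm R p3 f3" and "N4 = Lp_norm R p4 f4"
  have N: "0 \<le> N1" "0 \<le> N2" "0 \<le> N3" "0 \<le> N4"
    unfolding N1_def N2_def N3_def N4_def using fin ne by (simp_all add: Lp_norm_nonneg)
  have n_pos: "0 < n" using fin ne by (simp add: card_gt_0_iff)
  have n_eq: "n = real (card (carrier R)) ^ 2"
    by (simp add: plane_def card_cartesian_product power2_eq_square)
  have diamond: "diamond R t f1 f2 f3 f4 = quad f1 f2 f3 f4 / (n * ?d)"
    unfolding diamond_def quad_def n_eq by (simp only: times_divide_eq_left mult_1_left)
  have "(recip p1, recip p2, recip p3, recip p4) \<in> adm (196 * (n * ?d))"
    using region unfolding p[THEN recip_props(2)] p[THEN recip_props(3)] unfolding numeral_eq_ereal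
    by (intro adm_region recip_props(1) p) simp_all
  then have adm: "quad g1 g2 g3 g4 \<le> 196 * (n * ?d)"
    if "unit_ball (recip p1) g1" "unit_ball (recip p2) g2" "unit_ball (recip p3) g3"
      "unit_ball (recip p4) g4" for g1 g2 g3 g4
    using that by (simp add: adm_def)
  \<comment> \<open>The shift by \<open>e\<close> keeps the divisors positive when some norm
    vanishes; it is removed below by letting \<open>e\<close> tend to 0 from the right.\<close>
  have eps: "diamond R t f1 f2 f3 f4 \<le> 196 * ((N1 + e) * (N2 + e) * (N3 + e) * (N4 + e))"
    if e: "0 < e" for e
  proof -
    have pos: "0 < N1 + e" "0 < N2 + e" "0 < N3 + e" "0 < N4 + e" using N e by auto
    have "quad (\<lambda>x. f1 x / (N1 + e)) (\<lambda>x. f2 x / (N2 + e)) (\<lambda>x. f3 x / (N3 + e)) (\<lambda>x. f4 x / (N4 + e))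
        \<le> 196 * (n * ?d)"
      using nn e by (intro adm unit_ball_Lp_norm[OF graph] p pos)
        (auto simp: N1_def N2_def N3_def N4_def)
    moreover define P where "P = (N1 + e) * (N2 + e) * (N3 + e) * (N4 + e)"
    ultimately have "quad f1 f2 f3 f4 / P \<le> 196 * (n * ?d)"
      by (simp only: quad_scale)
    moreover have "0 < P" using pos by (simp add: P_def)
    ultimately have "quad f1 f2 f3 f4 \<le> (196 * P) * (n * ?d)"
      by (simp add: pos_divide_le_eq mult.commute mult.left_commute)
    then have "quad f1 f2 f3 f4 / (n * ?d) \<le> 196 * P"
      using n_pos d_pos by (subst pos_divide_le_eq) auto
    then show ?thesis by (simp add: diamond P_def)
  qed
  have "((\<lambda>e. 196 * ((N1 + e) * (N2 + e) * (N3 + e) * (N4 + e))) \<longlongrightarrow>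
      196 * ((N1 + 0) * (N2 + 0) * (N3 + 0) * (N4 + 0))) (at_right 0)"
    by (intro tendsto_intros)
  moreover have "eventually (\<lambda>e. diamond R t f1 f2 f3 f4 \<le>
      196 * ((N1 + e) * (N2 + e) * (N3 + e) * (N4 + e))) (at_right 0)"
    by (rule eventually_mono[OF eventually_at_right_less]) (rule eps)
  ultimately have "diamond R t f1 f2 f3 f4 \<le> 196 * ((N1 + 0) * (N2 + 0) * (N3 + 0) * (N4 + 0))"
    by (rule tendsto_lowerbound) simp
  then show "diamond R t f1 f2 f3 f4 \<le>
      196 * (Lp_norm R p1 f1 * Lp_norm R p2 f2 * Lp_norm R p3 f3 * Lp_norm R p4 f4)"
    by (simp add: N1_def N2_def N3_def N4_def)
qed

lemma diamond_lesssim_region: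
  assumes "1 \<le> p1" "1 \<le> p2" "1 \<le> p3" "1 \<le> p4"
    and "1 / p1 + 1 / p2 + 2 / p3 + 1 / p4 \<le> 2" "2 / p1 + 1 / p2 + 1 / p3 + 1 / p4 \<le> 2"
      "1 / p1 + 2 / p2 + 1 / p3 + 2 / p4 \<le> 2"
  shows "diamond_lesssim p1 p2 p3 p4"
  unfolding diamond_lesssim_def
proof (intro exI[of _ 196] conjI allI impI)
  fix R :: "nat ring" and t
  assume R: "adm_field R" and "t \<in> carrier R - {\<zero>\<^bsub>R\<^esub>}"
  then have "diamond_bound R t p1 p2 p3 p4 196" using assms by (rule diamond_bound_region)
  then show "diamond_const R t p1 p2 p3 p4 \<le> ereal 196"
    by (simp only: diamond_const_le_iff[OF R])
qed simp

lemma diamond_lesssim_imp_lessapprox: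
  assumes "diamond_lesssim p1 p2 p3 p4"
  shows "diamond_lessapprox p1 p2 p3 p4"
proof -
  obtain C where C: "1 \<le> C" "\<And>(R :: nat ring) t. adm_field R \<Longrightarrow> t \<in> carrier R - {\<zero>\<^bsub>R\<^esub>} \<Longrightarrow>
      diamond_bound R t p1 p2 p3 p4 C"
    using assms unfolding diamond_lesssim_def by (metis diamond_const_le_iff)
  show ?thesis
    unfolding diamond_lessapprox_def
  proof (intro exI[of _ C] conjI allI impI)
    fix R :: "nat ring" and t and E1 E2 E3 E4 :: "(nat \<times> nat) set"
    assume "adm_field R" "t \<in> carrier R - {\<zero>\<^bsub>R\<^esub>}"
    from C(2)[OF this] show "diamond R t (indicator E1) (indicator E2) (indicator E3) (indicator E4) \<le>
        C * (Lp_norm R p1 (indicator E1) * Lp_norm R p2 (indicator E2) *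
          Lp_norm R p3 (indicator E3) * Lp_norm R p4 (indicator E4))"
      unfolding diamond_bound_def by simp
  qed (rule C(1))
qed

theorem theorem6p6:
  shows "(\<forall>p1 p2 p3 p4 :: ereal.
            1 \<le> p1 \<and> 1 \<le> p2 \<and> 1 \<le> p3 \<and> 1 \<le> p4 \<and>
            1 / p1 + 1 / p2 + 2 / p3 + 1 / p4 \<le> 2 \<and>
            2 / p1 + 1 / p2 + 1 / p3 + 1 / p4 \<le> 2 \<and>
            1 / p1 + 2 / p2 + 1 / p3 + 2 / p4 \<le> 2 \<and>
            (p1, p2, p3, p4) \<noteq> (2, 2, 2, \<infinity>) \<and>
            (p1, p2, p3, p4) \<noteq> (2, \<infinity>, 2, 2) \<longrightarrow>
            diamond_lesssim p1 p2 p3 p4) \<and>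
         diamond_lessapprox 2 \<infinity> 2 2 \<and>
         diamond_lessapprox 2 2 2 \<infinity>"
proof (intro conjI)
  have half: "1 / 2 = ereal (1 / 2)" "2 / 2 = ereal 1"
    unfolding one_ereal_def numeral_eq_ereal by simp_all
  have two: "(2 :: ereal) = ereal 2" by (rule numeral_eq_ereal)
  \<comment> \<open>At both exceptional points all three constraints hold with equality, so the
    strong-type bound applies there and restricts to indicator functions.\<close>
  have sums: "1 / 2 + 1 / 2 + 2 / 2 + 1 / \<infinity> \<le> (2 :: ereal)" "2 / 2 + 1 / 2 + 1 / 2 + 1 / \<infinity> \<le> (2 :: ereal)"
    "1 / 2 + 2 / 2 + 1 / 2 + 2 / \<infinity> \<le> (2 :: ereal)"
    "1 / 2 + 1 / \<infinity> + 2 / 2 + 1 / 2 \<le> (2 :: ereal)" "2 / 2 + 1 / \<infinity> + 1 / 2 + 1 / 2 \<le> (2 :: ereal)"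
    "1 / 2 + 2 / \<infinity> + 1 / 2 + 2 / 2 \<le> (2 :: ereal)"
    unfolding half unfolding two by simp_all
  show "diamond_lessapprox 2 \<infinity> 2 2" "diamond_lessapprox 2 2 2 \<infinity>"
    using sums by (auto intro!: diamond_lesssim_imp_lessapprox diamond_lesssim_region)
qed (blast intro: diamond_lesssim_region)

end
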